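(* It is not true that for every spectrum there is a maximally entangled two-qubit state with that spectrum. That is, there exists $\vec\lambda=(\lambda_1,\lambda_2,\lambda_3,\lambda_4)$ with $\lambda_1\ge\lambda_2\ge\lambda_3\ge\lambda_4\ge0$ and $\sum_i\lambda_i=1$ such that no state in the set $S_{\vec\lambda}$ of all two-qubit states with spectrum $\vec\lambda$ is maximally entangled in $S_{\vec\lambda}$, i.e. there is no $\rho\in S_{\vec\lambda}$ such that for every $\sigma\in S_{\vec\lambda}$ there is an LOCC map $\Lambda$ with $\Lambda(\rho)=\sigma$.
   Context: A two-qubit state is a $4\times4$ unit-trace Hermitian positive semidefinite complex matrix acting on $\mathbb{C}^2\otimes\mathbb{C}^2$; its spectrum is the list of its eigenvalues counted with multiplicity, in non-increasing order. Given a set $S$ of two-qubit states, a state in $S$ is called maximally entangled in $S$ if it can be transformed by LOCC into every other state in $S$. LOCC (local operations and classical communication): an LOCC map is a completely positive trace-preserving map from two-qubit states to two-qubit states that can be implemented by a protocol with finitely many rounds, where in each round one of the two parties applies to their own subsystem a quantum instrument (a finite family of completely positive maps whose sum is trace preserving, possibly changing the local dimension) chosen depending on all previous measurement outcomes, and communicates the outcome to the other party; at the end both local systems are qubits and the measurement outcomes may be discarded (i.e. the branches are summed). *)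

theory Defs
  imports "Jordan_Normal_Form.Schur_Decomposition"
begin

text \<open>
  Operators on \<open>\<complex>\<^sup>a \<otimes> \<complex>\<^sup>b\<close> are complex matrices of size \<open>a * b\<close>, where the product basis vector
  \<open>e\<^sub>i \<otimes> e\<^sub>j\<close> (with \<open>i < a\<close>, \<open>j < b\<close>) has index \<open>i * b + j\<close>.
\<close>

definition mat_trace :: "complex mat \<Rightarrow> complex" where
  "mat_trace A = (\<Sum>i<dim_row A. A $$ (i, i))"

text \<open>The order on \<open>complex\<close> is such that \<open>0 \<le> z\<close> means that \<open>z\<close> is real and nonnegative.\<close>

definition psd :: "nat \<Rightarrow> complex mat \<Rightarrow> bool" where
  "psd n A \<longleftrightarrow> A \<in> carrier_mat n n \<and> mat_adjoint A = A \<and>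
     (\<forall>v\<in>carrier_vec n. 0 \<le> (A *\<^sub>v v) \<bullet>c v)"

definition two_qubit_state :: "complex mat \<Rightarrow> bool" where
  "two_qubit_state \<rho> \<longleftrightarrow> psd (2 * 2) \<rho> \<and> mat_trace \<rho> = 1"

definition has_spectrum :: "complex mat \<Rightarrow> real list \<Rightarrow> bool" where
  "has_spectrum A ls \<longleftrightarrow> sorted_wrt (\<ge>) ls \<and>
     mset (map complex_of_real ls) = proots (char_poly A)"

definition states_with_spectrum :: "real list \<Rightarrow> complex mat set" where
  "states_with_spectrum ls = {\<rho>. two_qubit_state \<rho> \<and> has_spectrum \<rho> ls}"

text \<open>
  Maps from operators on \<open>\<complex>\<^sup>d\<close> to operators on \<open>\<complex>\<^sup>e\<close> are functions on \<open>complex mat\<close>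
  of which only the values on \<open>carrier_mat d d\<close> matter.
\<close>

definition linear_on :: "nat \<Rightarrow> nat \<Rightarrow> (complex mat \<Rightarrow> complex mat) \<Rightarrow> bool" where
  "linear_on d e E \<longleftrightarrow>
     (\<forall>X\<in>carrier_mat d d. E X \<in> carrier_mat e e) \<and>
     (\<forall>X\<in>carrier_mat d d. \<forall>Y\<in>carrier_mat d d. E (X + Y) = E X + E Y) \<and>
     (\<forall>a. \<forall>X\<in>carrier_mat d d. E (a \<cdot>\<^sub>m X) = a \<cdot>\<^sub>m E X)"

text \<open>
  The extension \<open>E \<otimes> id\<^sub>k\<close>, from size \<open>d * k\<close> to size \<open>e * k\<close>, and
  the extension \<open>id\<^sub>k \<otimes> E\<close>, from size \<open>k * d\<close> to size \<open>k * e\<close>,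
  of a map \<open>E\<close> from size \<open>d\<close> to size \<open>e\<close>.
\<close>

definition act_left ::
  "nat \<Rightarrow> nat \<Rightarrow> nat \<Rightarrow> (complex mat \<Rightarrow> complex mat) \<Rightarrow> complex mat \<Rightarrow> complex mat" where
  "act_left d e k E X = mat (e * k) (e * k) (\<lambda>(r, c).
     E (mat d d (\<lambda>(i, j). X $$ (i * k + r mod k, j * k + c mod k))) $$ (r div k, c div k))"

definition act_right ::
  "nat \<Rightarrow> nat \<Rightarrow> nat \<Rightarrow> (complex mat \<Rightarrow> complex mat) \<Rightarrow> complex mat \<Rightarrow> complex mat" where
  "act_right k d e E X = mat (k * e) (k * e) (\<lambda>(r, c).
     E (mat d d (\<lambda>(i, j). X $$ ((r div e) * d + i, (c div e) * d + j))) $$ (r mod e, c mod e))"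

definition kron :: "complex mat \<Rightarrow> complex mat \<Rightarrow> complex mat" where
  "kron A B = mat (dim_row A * dim_row B) (dim_col A * dim_col B) (\<lambda>(r, c).
     A $$ (r div dim_row B, c div dim_col B) * B $$ (r mod dim_row B, c mod dim_col B))"

lemma act_left_kron:
  assumes "linear_on d e E" "A \<in> carrier_mat d d" "B \<in> carrier_mat k k"
  shows "act_left d e k E (kron A B) = kron (E A) B"
proof -
  have EA: "E A \<in> carrier_mat e e" using assms(1,2) by (auto simp: linear_on_def)
  show ?thesis
  proof (rule eq_matI)
    fix r c assume "r < dim_row (kron (E A) B)" "c < dim_col (kron (E A) B)"
    then have r: "r < e * k" and c: "c < e * k" using EA assms(3) by (auto simp: kron_def)
    then have k: "k > 0" by (cases k) auto
    have "i * k + m < d * k" if "i < d" "m < k" for i m :: nat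
    proof -
      have "i * k + m < Suc i * k" using that by simp
      also have "\<dots> \<le> d * k" using that by (intro mult_le_mono1) simp
      finally show ?thesis .
    qed
    then have "mat d d (\<lambda>(i, j). kron A B $$ (i * k + r mod k, j * k + c mod k))
      = B $$ (r mod k, c mod k) \<cdot>\<^sub>m A"
      using assms(2,3) k by (intro eq_matI) (auto simp: kron_def)
    moreover have "E (a \<cdot>\<^sub>m A) = a \<cdot>\<^sub>m E A" for a
      using assms(1,2) by (auto simp: linear_on_def)
    moreover have "r div k < e" "c div k < e" using r c by (simp_all add: less_mult_imp_div_less)
    ultimately show "act_left d e k E (kron A B) $$ (r, c) = kron (E A) B $$ (r, c)"
      using r c EA assms(3) by (simp add: act_left_def kron_def mult.commute)
  qed (use EA assms(3) in \<open>auto simp: act_left_def kron_def\<close>)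
qed

lemma act_right_kron:
  assumes "linear_on d e E" "A \<in> carrier_mat k k" "B \<in> carrier_mat d d"
  shows "act_right k d e E (kron A B) = kron A (E B)"
proof -
  have EB: "E B \<in> carrier_mat e e" using assms(1,3) by (auto simp: linear_on_def)
  show ?thesis
  proof (rule eq_matI)
    fix r c assume "r < dim_row (kron A (E B))" "c < dim_col (kron A (E B))"
    then have r: "r < k * e" and c: "c < k * e" using EB assms(2) by (auto simp: kron_def)
    then have e: "e > 0" by (cases e) auto
    have rc: "r div e < k" "c div e < k" using r c by (simp_all add: less_mult_imp_div_less)
    have "i * d + m < k * d" if "i < k" "m < d" for i m :: nat
    proof -
      have "i * d + m < Suc i * d" using that by simp
      also have "\<dots> \<le> k * d" using that by (intro mult_le_mono1) simp
      finally show ?thesis .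
    qed
    then have "mat d d (\<lambda>(i, j). kron A B $$ ((r div e) * d + i, (c div e) * d + j))
      = A $$ (r div e, c div e) \<cdot>\<^sub>m B"
      using assms(2,3) rc by (intro eq_matI) (auto simp: kron_def)
    moreover have "E (a \<cdot>\<^sub>m B) = a \<cdot>\<^sub>m E B" for a
      using assms(1,3) by (auto simp: linear_on_def)
    ultimately show "act_right k d e E (kron A B) $$ (r, c) = kron A (E B) $$ (r, c)"
      using r c e EB assms(2) by (simp add: act_right_def kron_def)
  qed (use EB assms(2) in \<open>auto simp: act_right_def kron_def\<close>)
qed

definition completely_positive :: "nat \<Rightarrow> nat \<Rightarrow> (complex mat \<Rightarrow> complex mat) \<Rightarrow> bool" where
  "completely_positive d e E \<longleftrightarrow> linear_on d e E \<and>
     (\<forall>k X. psd (k * d) X \<longrightarrow> psd (k * e) (act_right k d e E X))"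

definition trace_preserving :: "nat \<Rightarrow> (complex mat \<Rightarrow> complex mat) \<Rightarrow> bool" where
  "trace_preserving d E \<longleftrightarrow> (\<forall>X\<in>carrier_mat d d. mat_trace (E X) = mat_trace X)"

definition family_sum ::
  "nat \<Rightarrow> nat \<Rightarrow> (nat \<Rightarrow> complex mat \<Rightarrow> complex mat) \<Rightarrow> complex mat \<Rightarrow> complex mat" where
  "family_sum e n F X = mat e e (\<lambda>(r, c). \<Sum>i<n. F i X $$ (r, c))"

definition instrument :: "nat \<Rightarrow> nat \<Rightarrow> nat \<Rightarrow> (nat \<Rightarrow> complex mat \<Rightarrow> complex mat) \<Rightarrow> bool" where
  "instrument d e n E \<longleftrightarrow>
     (\<forall>i<n. completely_positive d e (E i)) \<and> trace_preserving d (family_sum e n E)"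

text \<open>
  \<open>locc_protocol a b \<Phi>\<close>: starting from local dimensions \<open>a\<close> and \<open>b\<close>, the map \<open>\<Phi>\<close> is implemented
  by a finite protocol tree ending in two qubits. After outcome \<open>i\<close> the protocol continues with
  \<open>\<Psi> i\<close>, so everything that follows may depend on all earlier outcomes.
\<close>

inductive locc_protocol :: "nat \<Rightarrow> nat \<Rightarrow> (complex mat \<Rightarrow> complex mat) \<Rightarrow> bool" where
  finish: "locc_protocol 2 2 (\<lambda>X. X)"
| left_party: "locc_protocol a b (family_sum (2 * 2) n (\<lambda>i X. \<Psi> i (act_left a a' b (E i) X)))"
    if "instrument a a' n E" and "\<And>i. i < n \<Longrightarrow> locc_protocol a' b (\<Psi> i)"
| right_party: "locc_protocol a b (family_sum (2 * 2) n (\<lambda>i X. \<Psi> i (act_right a b b' (E i) X)))"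
    if "instrument b b' n E" and "\<And>i. i < n \<Longrightarrow> locc_protocol a b' (\<Psi> i)"

definition locc_map :: "(complex mat \<Rightarrow> complex mat) \<Rightarrow> bool" where
  "locc_map \<Lambda> \<longleftrightarrow> completely_positive (2 * 2) (2 * 2) \<Lambda> \<and> trace_preserving (2 * 2) \<Lambda> \<and>
     locc_protocol 2 2 \<Lambda>"

definition maximally_entangled_in :: "complex mat set \<Rightarrow> complex mat \<Rightarrow> bool" where
  "maximally_entangled_in S \<rho> \<longleftrightarrow> \<rho> \<in> S \<and> (\<forall>\<sigma>\<in>S. \<exists>\<Lambda>. locc_map \<Lambda> \<and> \<Lambda> \<rho> = \<sigma>)"

end

theory Submission
  imports Defs "HOL-Computational_Algebra.Fundamental_Theorem_Algebra"
begin

text \<open>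
  The counterexample is the spectrum \<open>(1/2, 1/2, 0, 0)\<close>. A two-dimensional subspace of
  \<open>\<complex>\<^sup>2 \<otimes> \<complex>\<^sup>2\<close> contains a product vector \<open>v = f \<otimes> g\<close>, since the determinant of a combination of two
  \<open>2 \<times> 2\<close> matrices has a root; hence a state with this spectrum is \<open>\<tau> = v v\<^sup>* / 2 + \<Sum> u u\<^sup>*\<close>.
  Let an LOCC map with product Kraus operators \<open>A \<otimes> B\<close> send \<open>\<tau>\<close> to the state
  \<open>(e\<^sub>0\<^sub>0 e\<^sub>0\<^sub>0\<^sup>* + \<chi> \<chi>\<^sup>*) / 2\<close> with \<open>\<chi> = a e\<^sub>0\<^sub>1 + b e\<^sub>1\<^sub>0\<close> and \<open>a b \<noteq> 0\<close>.
  The only product vectors in its range are multiples of \<open>e\<^sub>0\<^sub>0\<close>, so \<open>(A \<otimes> B) v\<close> is one.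
  As each \<open>(A \<otimes> B) u\<close> is also in the range, the amplitude of \<open>(A \<otimes> B) u\<close> at \<open>e\<^sub>0\<^sub>1\<close>, if not zero,
  comes only from the component of \<open>u\<close> along \<open>f \<otimes> g\<^sup>\<bottom>\<close>, and that at \<open>e\<^sub>1\<^sub>0\<close> only from the component
  along \<open>f\<^sup>\<bottom> \<otimes> g\<close>. By trace preservation the total weights \<open>x\<close> and \<open>y\<close> of these components satisfy
  \<open>a\<^sup>2 / 2 \<le> x\<close> and \<open>b\<^sup>2 / 2 \<le> y\<close>, whereas \<open>x + y \<le> 1/2\<close>.
  So \<open>(a, b) = (4/5, 3/5)\<close> and \<open>(3/5, 4/5)\<close> cannot both be reached.
\<close>

section \<open>Positive kernels as sums of rank-one kernels\<close>

text \<open>Passes to entries and coefficient functions, so that positivity of a matrix becomes a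
  statement about a finite double sum; all later positivity arguments take place in this
  form.\<close>

lemma psd_iff:
  "psd n A \<longleftrightarrow> A \<in> carrier_mat n n \<and> (\<forall>i<n. \<forall>j<n. A $$ (j, i) = cnj (A $$ (i, j))) \<and>
     (\<forall>c. 0 \<le> (\<Sum>i<n. \<Sum>j<n. cnj (c i) * A $$ (i, j) * c j))"
proof (cases "A \<in> carrier_mat n n")
  case True
  have carr: "mat_adjoint A \<in> carrier_mat n n"
    using True by (intro carrier_matI) (simp_all add: mat_adjoint_def)
  have entry: "mat_adjoint A $$ (i, j) = cnj (A $$ (j, i))" if "i < n" "j < n" for i j
    using that True by (simp add: mat_adjoint_def mat_of_rows_index)
  have adj: "mat_adjoint A = A \<longleftrightarrow> (\<forall>i<n. \<forall>j<n. A $$ (j, i) = cnj (A $$ (i, j)))" (is "_ \<longleftrightarrow> ?h")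
  proof
    assume "mat_adjoint A = A"
    show ?h
      by (intro allI impI) (rule entry[unfolded \<open>mat_adjoint A = A\<close>])
  next
    assume ?h
    then have "mat_adjoint A $$ (i, j) = A $$ (i, j)" if "i < n" "j < n" for i j
      unfolding entry[OF that] using \<open>?h\<close> that by metis
    then show "mat_adjoint A = A" using carr True by (intro eq_matI) simp_all
  qed
  have quad: "(A *\<^sub>v v) \<bullet>c v = (\<Sum>i<n. \<Sum>j<n. cnj (v $ i) * A $$ (i, j) * v $ j)"
    if "v \<in> carrier_vec n" for v
    using that True
    by (simp add: scalar_prod_def sum_distrib_left sum_distrib_right atLeast0LessThan
        conjugate_complex_def mult_ac)
  have "(\<forall>v\<in>carrier_vec n. 0 \<le> (A *\<^sub>v v) \<bullet>c v) \<longleftrightarrow>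
      (\<forall>c. 0 \<le> (\<Sum>i<n. \<Sum>j<n. cnj (c i) * A $$ (i, j) * c j))" (is "?l \<longleftrightarrow> ?r")
  proof
    assume ?l
    show ?r
    proof
      fix c :: "nat \<Rightarrow> complex"
      have v: "vec n c \<in> carrier_vec n" by simp
      show "0 \<le> (\<Sum>i<n. \<Sum>j<n. cnj (c i) * A $$ (i, j) * c j)"
        using \<open>?l\<close>[rule_format, OF v] unfolding quad[OF v] by simp
    qed
  next
    assume ?r
    then show ?l using quad by simp
  qed
  then show ?thesis unfolding psd_def adj using True by blast
qed (auto simp: psd_def)

text \<open>The quadratic form at \<open>c\<close> is the sum of the squared moduli of the inner
  products of \<open>c\<close> with the vectors \<open>w\<close>.\<close>

lemma psd_rank_one_sum:
  "psd n (mat n n (\<lambda>(i, j). \<Sum>w\<leftarrow>ws. w i * cnj (w j)))"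
proof -
  have one: "(\<Sum>i<n. cnj (c i) * w i) * cnj (\<Sum>i<n. cnj (c i) * w i)
      = (\<Sum>i<n. \<Sum>j<n. cnj (c i) * (w i * cnj (w j)) * c j)" for c w
    unfolding cnj_sum sum_product by (simp add: mult_ac)
  have "(\<Sum>i<n. \<Sum>j<n. cnj (c i) * (\<Sum>w\<leftarrow>ws. w i * cnj (w j)) * c j)
      = (\<Sum>w\<leftarrow>ws. (\<Sum>i<n. cnj (c i) * w i) * cnj (\<Sum>i<n. cnj (c i) * w i))" for c
    unfolding one by (induction ws) (simp_all add: distrib_left distrib_right sum.distrib)
  moreover have "0 \<le> (\<Sum>w\<leftarrow>ws. (\<Sum>i<n. cnj (c i) * w i) * cnj (\<Sum>i<n. cnj (c i) * w i))" for c
    unfolding complex_norm_square[symmetric]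
    by (intro sum_list_nonneg) (auto simp: less_eq_complex_def)
  moreover have "cnj (\<Sum>w\<leftarrow>ws. w i * cnj (w j)) = (\<Sum>w\<leftarrow>ws. w j * cnj (w i))" for i j
    by (induction ws) auto
  ultimately show ?thesis
    by (simp add: psd_iff)
qed

text \<open>Cholesky decomposition: one index at a time is split off by completing the square.\<close>

lemma psd_kernel_decomposition:
  fixes M :: "'a \<Rightarrow> 'a \<Rightarrow> complex"
  assumes "finite S"
    and "\<And>i j. i \<in> S \<Longrightarrow> j \<in> S \<Longrightarrow> M j i = cnj (M i j)"
    and "\<And>c. 0 \<le> (\<Sum>i\<in>S. \<Sum>j\<in>S. cnj (c i) * M i j * c j)"
  shows "\<exists>ws. \<forall>i\<in>S. \<forall>j\<in>S. M i j = (\<Sum>w\<leftarrow>ws. w i * cnj (w j))"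
  using assms
proof (induction S arbitrary: M rule: finite_induct)
  case empty
  then show ?case by simp
next
  case (insert x S)
  define Q where "Q M S c = (\<Sum>i\<in>S. \<Sum>j\<in>S. cnj (c i) * M i j * c j)"
    for M :: "'a \<Rightarrow> 'a \<Rightarrow> complex" and S c
  have herm: "M j i = cnj (M i j)" if "i \<in> insert x S" "j \<in> insert x S" for i j
    using insert.prems(1) that by blast
  have pos: "0 \<le> Q M (insert x S) c" for c
    using insert.prems(2) by (simp add: Q_def)
  \<comment> \<open>The form as a function of the coordinate \<open>t\<close> at the new index
    \<open>x\<close>: a quadratic term, a linear term with its conjugate, and the form on
    \<open>S\<close>.\<close>
  have step: "Q M (insert x S) (c(x := t)) = cnj t * M x x * t + cnj t * (\<Sum>j\<in>S. M x j * c j)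
      + cnj (\<Sum>j\<in>S. M x j * c j) * t + Q M S c" for c t
  proof -
    define c' where "c' = c(x := t)"
    have c': "c' x = t" "\<And>i. i \<in> S \<Longrightarrow> c' i = c i"
      using insert.hyps by (auto simp: c'_def)
    have "Q M (insert x S) c' = cnj (c' x) * M x x * c' x + (\<Sum>j\<in>S. cnj (c' x) * M x j * c' j)
        + ((\<Sum>i\<in>S. cnj (c' i) * M i x * c' x) + Q M S c')"
      using insert.hyps by (simp add: Q_def sum.distrib)
    also have "(\<Sum>i\<in>S. cnj (c' i) * M i x * c' x) = cnj (\<Sum>j\<in>S. M x j * c j) * t"
      unfolding sum_distrib_right cnj_sum using herm[of x] c' by (intro sum.cong) auto
    also have "(\<Sum>j\<in>S. cnj (c' x) * M x j * c' j) = cnj t * (\<Sum>j\<in>S. M x j * c j)"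
      unfolding sum_distrib_left using c' by (intro sum.cong) auto
    also have "Q M S c' = Q M S c"
      unfolding Q_def using c' by (intro sum.cong) auto
    finally show ?thesis by (simp only: c'_def fun_upd_same add.assoc)
  qed
  have d: "0 \<le> M x x"
  proof -
    have "Q M (insert x S) ((\<lambda>_. 0)(x := 1)) = M x x"
      by (subst step) (simp add: Q_def)
    then show ?thesis using pos by metis
  qed
  obtain u M' where M': "\<And>i j. i \<in> insert x S \<Longrightarrow> j \<in> insert x S \<Longrightarrow> M i j = u i * cnj (u j) + M' i j"
    and row: "\<And>i. i \<in> insert x S \<Longrightarrow> M' i x = 0 \<and> M' x i = 0"
    and pos': "\<And>c. 0 \<le> Q M' S c"
  proof (cases "M x x = 0")
    case True
    \<comment> \<open>A zero diagonal entry forces a zero row: along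
      \<open>e(x := - t * M x j)\<close> the form is affine in \<open>t\<close> with slope
      \<open>- 2 * r\<close>, hence negative for large \<open>t\<close>.\<close>
    have z: "M x j = 0" if j: "j \<in> S" for j
    proof (rule ccontr)
      assume nz: "M x j \<noteq> 0"
      define r where "r = (norm (M x j))\<^sup>2"
      have r: "r > 0" using nz by (simp add: r_def)
      define e where "e = (\<lambda>i. if i = j then 1 else (0::complex))"
      have e: "(\<Sum>i\<in>S. f i * e i) = f j" for f
        using insert.hyps j by (simp add: e_def if_distrib sum.delta cong: if_cong)
      have "cnj (e i) = e i" for i by (simp add: e_def)
      then have e': "(\<Sum>i\<in>S. cnj (e i) * f i) = f j" for f using e[of f] by (simp add: mult.commute)
      have Qe: "Q M S e = M j j"
        unfolding Q_def e by (simp add: mult.assoc e')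
      have *: "0 \<le> M j j - complex_of_real (2 * t * r)" for t :: real
      proof -
        have "Q M (insert x S) (e(x := - t * M x j)) = M j j - 2 * t * (M x j * cnj (M x j))"
          unfolding step Qe e True by (simp add: algebra_simps)
        also have "M x j * cnj (M x j) = r"
          unfolding r_def by (rule complex_norm_square[symmetric])
        finally show ?thesis using pos[of "e(x := - t * M x j)"]
          by (simp del: fun_upd_apply)
      qed
      have "0 \<le> Re (M j j) - 2 * t * r" for t
        using *[of t] by (simp only: less_eq_complex_def minus_complex.sel Re_complex_of_real) simp
      \<comment> \<open>This value of \<open>t\<close> makes the form equal to -1.\<close>
      moreover have "2 * ((Re (M j j) + 1) / (2 * r)) * r = Re (M j j) + 1"
        using r by simp
      ultimately have "0 \<le> Re (M j j) - (Re (M j j) + 1)" by metis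
      then show False by simp
    qed
    moreover have "M j x = 0" if "j \<in> S" for j using z[OF that] herm[of x j] that by simp
    ultimately have "\<And>i. i \<in> insert x S \<Longrightarrow> M i x = 0 \<and> M x i = 0" using True by auto
    moreover have "0 \<le> Q M S c" for c
      using pos[of "c(x := 0)"] unfolding step by simp
    ultimately show ?thesis by (intro that[of "\<lambda>_. 0" M]) auto
  next
    case False
    define d where "d = Re (M x x)"
    have d: "M x x = of_real d" "d > 0"
      using d False by (auto simp: d_def less_eq_complex_def complex_eq_iff)
    define M' where "M' i j = M i j - M i x * M x j / d" for i j
    have "0 \<le> Q M' S c" for c
    proof -
      define b where "b = (\<Sum>j\<in>S. M x j * c j)"
      have "Q M' S c = Q M S c - (\<Sum>i\<in>S. cnj (c i) * M i x) * b / d"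
        unfolding Q_def M'_def b_def times_divide_eq_right[symmetric] sum_product
        by (simp add: right_diff_distrib left_diff_distrib sum_subtractf sum_divide_distrib mult.assoc)
      also have "(\<Sum>i\<in>S. cnj (c i) * M i x) = cnj b"
        unfolding b_def cnj_sum using herm[of x] by (intro sum.cong) auto
      \<comment> \<open>The value \<open>- b / d\<close> at \<open>x\<close> minimises the form for
        fixed \<open>c\<close>, so the Schur complement \<open>M'\<close> inherits positivity from
        \<open>M\<close>.\<close>
      also have "Q M S c - cnj b * b / d = Q M (insert x S) (c(x := - b / d))"
        unfolding step b_def[symmetric] using d by (simp add: field_simps)
      finally show ?thesis using pos by metis
    qed
    moreover have "M i x / complex_of_real (sqrt d) * cnj (M j x / complex_of_real (sqrt d)) = M i x * M x j / d"
      if "j \<in> insert x S" for i j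
    proof -
      have "complex_of_real (sqrt d) * complex_of_real (sqrt d) = d"
        using d by (metis abs_of_pos of_real_mult real_sqrt_mult_self)
      then show ?thesis using herm[of j x] that by (simp add: field_simps)
    qed
    moreover have "M' i x = 0 \<and> M' x i = 0" for i using d by (simp add: M'_def)
    ultimately show ?thesis
      by (intro that[of "\<lambda>i. M i x / complex_of_real (sqrt d)" M']) (auto simp: M'_def)
  qed
  have "M' j i = cnj (M' i j)" if "i \<in> S" "j \<in> S" for i j
    using M'[of i j] M'[of j i] herm[of i j] that by simp
  from insert.IH[OF this pos'[unfolded Q_def]] obtain ws where ws:
    "\<forall>i\<in>S. \<forall>j\<in>S. M' i j = (\<Sum>w\<leftarrow>ws. w i * cnj (w j))" ..
  \<comment> \<open>Row and column \<open>x\<close> of \<open>M'\<close> vanish, so the vectors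
    found on \<open>S\<close> extend by zero at \<open>x\<close>.\<close>
  have "M' i j = (\<Sum>w\<leftarrow>map (\<lambda>w. w(x := 0)) ws. w i * cnj (w j))"
    if "i \<in> insert x S" "j \<in> insert x S" for i j
    using that ws row insert.hyps
    by (cases "i = x"; cases "j = x") (auto simp: o_def)
  then show ?case
    using M' by (intro exI[of _ "u # map (\<lambda>w. w(x := 0)) ws"]) simp
qed

section \<open>Kraus operators of completely positive maps\<close>

definition unit_mat :: "nat \<Rightarrow> nat \<Rightarrow> nat \<Rightarrow> complex mat" where
  "unit_mat d i j = mat d d (\<lambda>p. if p = (i, j) then 1 else 0)"

lemma unit_mat_carrier [simp]: "unit_mat d i j \<in> carrier_mat d d"
  by (simp add: unit_mat_def)

lemma linear_on_expand:
  assumes E: "linear_on d e E" and X: "X \<in> carrier_mat d d" and rs: "r < e" "s < e"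
  shows "E X $$ (r, s) = (\<Sum>i<d. \<Sum>j<d. X $$ (i, j) * E (unit_mat d i j) $$ (r, s))"
proof -
  have carr: "E Y \<in> carrier_mat e e" if "Y \<in> carrier_mat d d" for Y
    using E that by (simp add: linear_on_def)
  have smult: "E (a \<cdot>\<^sub>m Y) $$ (r, s) = a * E Y $$ (r, s)" if "Y \<in> carrier_mat d d" for a Y
  proof -
    have "E (a \<cdot>\<^sub>m Y) = a \<cdot>\<^sub>m E Y" using E that by (simp add: linear_on_def)
    then show ?thesis using carr[OF that] rs by simp
  qed
  have add: "E (Y + Z) $$ (r, s) = E Y $$ (r, s) + E Z $$ (r, s)"
    if "Y \<in> carrier_mat d d" "Z \<in> carrier_mat d d" for Y Z
  proof -
    have "E (Y + Z) = E Y + E Z" using E that by (simp add: linear_on_def)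
    then show ?thesis using carr[OF that(1)] carr[OF that(2)] rs by simp
  qed
  \<comment> \<open>Induction on a set \<open>S\<close> of positions outside which \<open>Y\<close>
    vanishes: clearing one entry costs one use of additivity.\<close>
  have "E Y $$ (r, s) = (\<Sum>p\<in>S. Y $$ p * E (unit_mat d (fst p) (snd p)) $$ (r, s))"
    if "finite S" "S \<subseteq> {..<d} \<times> {..<d}" "Y \<in> carrier_mat d d"
      "\<And>p. p \<in> {..<d} \<times> {..<d} - S \<Longrightarrow> Y $$ p = 0" for S Y
    using that
  proof (induction S arbitrary: Y rule: finite_induct)
    case empty
    \<comment> \<open>The zero matrix is 0 times itself, so homogeneity alone gives its
      image.\<close>
    then have "Y = 0 \<cdot>\<^sub>m Y" by (intro eq_matI) auto
    then have "E Y $$ (r, s) = 0 * E Y $$ (r, s)" using smult[OF empty.prems(2)] by metis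
    then show ?case by simp
  next
    case (insert p S)
    define Z where "Z = mat d d (\<lambda>q. if q = p then 0 else Y $$ q)"
    have Z: "Z \<in> carrier_mat d d" by (simp add: Z_def)
    have Zq: "Z $$ q = (if q = p then 0 else Y $$ q)" if "q \<in> {..<d} \<times> {..<d}" for q
      using that by (cases q) (simp add: Z_def)
    have "Y = Y $$ p \<cdot>\<^sub>m unit_mat d (fst p) (snd p) + Z"
      using insert.prems(2) by (intro eq_matI) (auto simp: Z_def unit_mat_def)
    then have "E Y $$ (r, s) = Y $$ p * E (unit_mat d (fst p) (snd p)) $$ (r, s) + E Z $$ (r, s)"
      using add[OF smult_carrier_mat[OF unit_mat_carrier] Z] smult[OF unit_mat_carrier] by metis
    also have "E Z $$ (r, s) = (\<Sum>q\<in>S. Z $$ q * E (unit_mat d (fst q) (snd q)) $$ (r, s))"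
      using insert.prems Z by (intro insert.IH) (auto simp: Zq)
    also have "\<dots> = (\<Sum>q\<in>S. Y $$ q * E (unit_mat d (fst q) (snd q)) $$ (r, s))"
      using insert.hyps insert.prems(1) by (intro sum.cong refl) (subst Zq; auto)
    finally show ?case using insert.hyps by simp
  qed
  from this[of "{..<d} \<times> {..<d}" X] X show ?thesis
    by (simp add: sum.cartesian_product case_prod_beta)
qed

lemma sum_lessThan_mult:
  fixes f :: "nat \<Rightarrow> 'a::comm_monoid_add"
  shows "(\<Sum>p<m * n. f p) = (\<Sum>i<m. \<Sum>j<n. f (i * n + j))"
proof (induction m)
  case (Suc m)
  have "{..<Suc m * n} = {..<m * n} \<union> {m * n..<m * n + n}" by auto
  then have "(\<Sum>p<Suc m * n. f p) = (\<Sum>p<m * n. f p) + sum f {m * n..<m * n + n}"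
    by (simp add: sum.union_disjoint ivl_disj_int)
  also have "sum f {m * n..<m * n + n} = (\<Sum>j<n. f (m * n + j))"
    using sum.shift_bounds_nat_ivl[of f 0 "m * n" n]
    by (simp add: add.commute atLeast0LessThan)
  finally show ?case using Suc by simp
qed simp

text \<open>An entry of K X times the adjoint of K. The operator is a function of two indices, so
  its output dimension does not have to be recorded.\<close>

definition sandwich :: "nat \<Rightarrow> (nat \<Rightarrow> nat \<Rightarrow> complex) \<Rightarrow> complex mat \<Rightarrow> nat \<Rightarrow> nat \<Rightarrow> complex" where
  "sandwich d K X r s = (\<Sum>i<d. \<Sum>j<d. K r i * X $$ (i, j) * cnj (K s j))"

lemma sum_list_sum_swap:
  "(\<Sum>i\<in>S. \<Sum>w\<leftarrow>ws. f w i) = (\<Sum>w\<leftarrow>ws. \<Sum>i\<in>S. f w i)"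
  for f :: "'a \<Rightarrow> 'b \<Rightarrow> 'c::comm_monoid_add"
  by (induction ws) (simp_all add: sum.distrib)

text \<open>The Choi matrix, obtained from the unnormalised maximally entangled vector with \<open>k = d\<close>.\<close>

lemma choi_kernel_pos:
  assumes "completely_positive d e E"
  shows "0 \<le> (\<Sum>i<d. \<Sum>r<e. \<Sum>j<d. \<Sum>s<e. cnj (c i r) * E (unit_mat d i j) $$ (r, s) * c j s)"
    and "i < d \<Longrightarrow> j < d \<Longrightarrow> r < e \<Longrightarrow> s < e \<Longrightarrow>
      E (unit_mat d j i) $$ (s, r) = cnj (E (unit_mat d i j) $$ (r, s))"
proof -
  define w :: "nat \<Rightarrow> complex" where "w p = (if p div d = p mod d then 1 else 0)" for p
  define \<Omega> where "\<Omega> = mat (d * d) (d * d) (\<lambda>(i, j). \<Sum>w\<leftarrow>[w]. w i * cnj (w j))"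
  define C where "C = act_right d d e E \<Omega>"
  have "psd (d * d) \<Omega>" unfolding \<Omega>_def by (rule psd_rank_one_sum)
  then have C: "psd (d * e) C"
    using assms by (simp add: completely_positive_def C_def)
  have lt: "i * k + m < d * k" if "i < d" "m < k" for i m k :: nat
  proof -
    have "i * k + m < Suc i * k" using that by simp
    also have "\<dots> \<le> d * k" using that by (intro mult_le_mono1) simp
    finally show ?thesis .
  qed
  \<comment> \<open>Block (i, j) of the rank-one matrix built from the sum of all \<open>e_i\<close>
    tensor \<open>e_i\<close> is the matrix unit at (i, j), so block (i, j) of \<open>C\<close> is
    its image under \<open>E\<close>.\<close>
  have Cij: "C $$ (i * e + r, j * e + s) = E (unit_mat d i j) $$ (r, s)"
    if "i < d" "j < d" "r < e" "s < e" for i j r s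
  proof -
    have "mat d d (\<lambda>(m, n). \<Omega> $$ (i * d + m, j * d + n)) = unit_mat d i j"
      using that lt by (intro eq_matI) (auto simp: \<Omega>_def w_def unit_mat_def)
    then show ?thesis using that lt by (simp add: C_def act_right_def)
  qed
  define c' where "c' p = c (p div e) (p mod e)" for p
  have "0 \<le> (\<Sum>p<d * e. \<Sum>q<d * e. cnj (c' p) * C $$ (p, q) * c' q)"
    using C unfolding psd_iff by blast
  also have "\<dots> = (\<Sum>i<d. \<Sum>r<e. \<Sum>j<d. \<Sum>s<e. cnj (c i r) * E (unit_mat d i j) $$ (r, s) * c j s)"
    unfolding sum_lessThan_mult
    by (intro sum.cong refl) (simp add: Cij c'_def)
  finally show "0 \<le> (\<Sum>i<d. \<Sum>r<e. \<Sum>j<d. \<Sum>s<e. cnj (c i r) * E (unit_mat d i j) $$ (r, s) * c j s)" .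
  assume "i < d" "j < d" "r < e" "s < e"
  then show "E (unit_mat d j i) $$ (s, r) = cnj (E (unit_mat d i j) $$ (r, s))"
    using C lt[of i r e] lt[of j s e] Cij[of i j r s] Cij[of j i s r] unfolding psd_iff by metis
qed

text \<open>The Choi matrix is a positive kernel on pairs (input index, output index). Each vector
  of its rank-one decomposition, read as a matrix from inputs to outputs, is a Kraus
  operator.\<close>

lemma kraus_decomposition:
  assumes E: "completely_positive d e E"
  obtains Ks where "\<And>X r s. X \<in> carrier_mat d d \<Longrightarrow> r < e \<Longrightarrow> s < e \<Longrightarrow>
    E X $$ (r, s) = (\<Sum>K\<leftarrow>Ks. sandwich d K X r s)"
proof -
  define M where "M p q = E (unit_mat d (fst p) (fst q)) $$ (snd p, snd q)" for p q
  have "\<exists>ws. \<forall>p\<in>{..<d} \<times> {..<e}. \<forall>q\<in>{..<d} \<times> {..<e}. M p q = (\<Sum>w\<leftarrow>ws. w p * cnj (w q))"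
  proof (rule psd_kernel_decomposition)
    show "M q p = cnj (M p q)" if "p \<in> {..<d} \<times> {..<e}" "q \<in> {..<d} \<times> {..<e}" for p q
      unfolding M_def by (rule choi_kernel_pos(2)[OF E]) (use that in auto)
    show "0 \<le> (\<Sum>p\<in>{..<d} \<times> {..<e}. \<Sum>q\<in>{..<d} \<times> {..<e}. cnj (c p) * M p q * c q)" for c
    proof -
      have "(\<Sum>p\<in>{..<d} \<times> {..<e}. f p) = (\<Sum>i<d. \<Sum>r<e. f (i, r))" for f :: "nat \<times> nat \<Rightarrow> complex"
        by (simp add: sum.cartesian_product)
      then show ?thesis
        using choi_kernel_pos(1)[OF E, of "\<lambda>i r. c (i, r)"] by (simp add: M_def)
    qed
  qed simp
  then obtain ws where ws: "\<And>i j r s. i < d \<Longrightarrow> j < d \<Longrightarrow> r < e \<Longrightarrow> s < e \<Longrightarrow>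
      E (unit_mat d i j) $$ (r, s) = (\<Sum>w\<leftarrow>ws. w (i, r) * cnj (w (j, s)))"
    unfolding M_def by force
  show ?thesis
  proof (rule that[of "map (\<lambda>w r i. w (i, r)) ws"])
    fix X :: "complex mat" and r s assume X: "X \<in> carrier_mat d d" and rs: "r < e" "s < e"
    have "E X $$ (r, s) = (\<Sum>i<d. \<Sum>j<d. \<Sum>w\<leftarrow>ws. w (i, r) * X $$ (i, j) * cnj (w (j, s)))"
      using linear_on_expand[OF _ X rs, of E] E rs
      by (simp add: completely_positive_def ws sum_list_const_mult[symmetric] mult_ac)
    then show "E X $$ (r, s) = (\<Sum>K\<leftarrow>map (\<lambda>w r i. w (i, r)) ws. sandwich d K X r s)"
      by (simp add: sandwich_def sum_list_sum_swap o_def)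
  qed
qed

section \<open>Product Kraus operators of LOCC protocols\<close>

definition comp_op ::
  "nat \<Rightarrow> (nat \<Rightarrow> nat \<Rightarrow> complex) \<Rightarrow> (nat \<Rightarrow> nat \<Rightarrow> complex) \<Rightarrow> nat \<Rightarrow> nat \<Rightarrow> complex" where
  "comp_op m A K r i = (\<Sum>p<m. A r p * K p i)"

lemma sum_swap_pairs:
  "(\<Sum>i\<in>I. \<Sum>j\<in>J. \<Sum>p\<in>P. \<Sum>q\<in>Q. f i j p q) = (\<Sum>p\<in>P. \<Sum>q\<in>Q. \<Sum>i\<in>I. \<Sum>j\<in>J. f i j p q)"
proof -
  have pairs: "(\<Sum>x\<in>A \<times> B. g x) = (\<Sum>a\<in>A. \<Sum>b\<in>B. g (a, b))" for A B g
    by (simp add: sum.cartesian_product)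
  show ?thesis
    using sum.swap[of "\<lambda>(i, j) (p, q). f i j p q" "P \<times> Q" "I \<times> J"]
    by (simp add: pairs)
qed

text \<open>Appends one operation to an earlier one: conjugating by \<open>K\<close> and then by
  \<open>A\<close> is conjugating by the product \<open>A K\<close>. The inductive steps for
  protocols rest on this.\<close>

lemma sandwich_comp_op:
  assumes "\<And>p q. p < e \<Longrightarrow> q < e \<Longrightarrow> Y $$ (p, q) = (\<Sum>K\<leftarrow>Ks. sandwich d K X p q)"
  shows "sandwich e A Y r s = (\<Sum>K\<leftarrow>Ks. sandwich d (comp_op e A K) X r s)"
proof -
  have one: "(\<Sum>p<e. \<Sum>q<e. A r p * sandwich d K X p q * cnj (A s q))
      = sandwich d (comp_op e A K) X r s" for K
  proof -
    have "sandwich d (comp_op e A K) X r s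
        = (\<Sum>i<d. \<Sum>j<d. \<Sum>p<e. \<Sum>q<e. (A r p * K p i) * X $$ (i, j) * (cnj (A s q) * cnj (K q j)))"
      unfolding sandwich_def comp_op_def cnj_sum sum_distrib_right sum_distrib_left complex_cnj_mult
      by (rule sum.cong[OF refl], rule sum.cong[OF refl], rule sum.swap)
    also have "\<dots> = (\<Sum>p<e. \<Sum>q<e. \<Sum>i<d. \<Sum>j<d. (A r p * K p i) * X $$ (i, j) * (cnj (A s q) * cnj (K q j)))"
      by (rule sum_swap_pairs)
    also have "\<dots> = (\<Sum>p<e. \<Sum>q<e. A r p * sandwich d K X p q * cnj (A s q))"
      unfolding sandwich_def sum_distrib_right sum_distrib_left by (simp add: mult_ac)
    finally show ?thesis ..
  qed
  have "sandwich e A Y r s = (\<Sum>p<e. \<Sum>q<e. \<Sum>K\<leftarrow>Ks. A r p * sandwich d K X p q * cnj (A s q))"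
    unfolding sandwich_def[of e A Y]
    by (intro sum.cong refl) (simp add: assms sum_list_const_mult sum_list_mult_const)
  also have "\<dots> = (\<Sum>K\<leftarrow>Ks. \<Sum>p<e. \<Sum>q<e. A r p * sandwich d K X p q * cnj (A s q))"
    by (simp only: sum_list_sum_swap)
  finally show ?thesis by (simp only: one)
qed

lemma sum_list_concat_map:
  "(\<Sum>x\<leftarrow>concat (map g ys). f x) = (\<Sum>y\<leftarrow>ys. \<Sum>x\<leftarrow>g y. f x)"
  for f :: "'a \<Rightarrow> 'b::comm_monoid_add"
  by (induction ys) simp_all

lemma sum_list_upt: "(\<Sum>i\<leftarrow>[0..<n]. f i) = (\<Sum>i<n. f i)"
  for f :: "nat \<Rightarrow> 'a::comm_monoid_add"
  by (induction n) (simp_all add: add.commute)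

lemma sandwich_identity:
  assumes "r < d" "s < d"
  shows "sandwich d (\<lambda>r i. of_bool (r = i)) X r s = X $$ (r, s)"
proof -
  have "(\<Sum>j<d. of_bool (r = i) * X $$ (i, j) * cnj (of_bool (s = j)))
      = (if r = i then X $$ (i, s) else 0)" for i
  proof -
    have "(\<Sum>j<d. of_bool (r = i) * X $$ (i, j) * cnj (of_bool (s = j)))
        = (\<Sum>j<d. if s = j then of_bool (r = i) * X $$ (i, j) else 0)"
      by (intro sum.cong) auto
    then show ?thesis using assms by simp
  qed
  then show ?thesis using assms by (simp add: sandwich_def)
qed

text \<open>By induction on the protocol tree: a local instrument acts on one tensor factor, so its
  Kraus operators multiply one component of each pair and leave the other alone. Product inputs
  suffice here, because local maps send them to product matrices.\<close>

lemma locc_protocol_product_kraus: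
  assumes "locc_protocol a b \<Lambda>"
  shows "\<exists>Ls. \<forall>X\<in>carrier_mat a a. \<forall>Y\<in>carrier_mat b b. \<forall>r<2. \<forall>r'<2. \<forall>s<2. \<forall>s'<2.
    \<Lambda> (kron X Y) $$ (r * 2 + r', s * 2 + s')
      = (\<Sum>(A, B)\<leftarrow>Ls. sandwich a A X r s * sandwich b B Y r' s')"
  using assms
proof (induction rule: locc_protocol.induct)
  case finish
  show ?case
    by (intro exI[of _ "[(\<lambda>r i. of_bool (r = i), \<lambda>r i. of_bool (r = i))]"] ballI allI impI)
      (simp add: sandwich_identity kron_def)
next
  case (left_party a a' n E b \<Psi>)
  have cp: "completely_positive a a' (E i)" if "i < n" for i
    using left_party.hyps that by (simp add: instrument_def)
  have "\<forall>i. \<exists>Ks. i < n \<longrightarrow> (\<forall>X\<in>carrier_mat a a. \<forall>r<a'. \<forall>s<a'.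
      E i X $$ (r, s) = (\<Sum>K\<leftarrow>Ks. sandwich a K X r s))"
    using kraus_decomposition[OF cp] by metis
  then obtain Ks where Ks: "\<And>i X r s. i < n \<Longrightarrow> X \<in> carrier_mat a a \<Longrightarrow> r < a' \<Longrightarrow> s < a' \<Longrightarrow>
      E i X $$ (r, s) = (\<Sum>K\<leftarrow>Ks i. sandwich a K X r s)"
    by metis
  from left_party.IH obtain Ls where Ls: "\<And>i X Y r r' s s'. i < n \<Longrightarrow> X \<in> carrier_mat a' a' \<Longrightarrow>
      Y \<in> carrier_mat b b \<Longrightarrow> r < 2 \<Longrightarrow> r' < 2 \<Longrightarrow> s < 2 \<Longrightarrow> s' < 2 \<Longrightarrow>
      \<Psi> i (kron X Y) $$ (r * 2 + r', s * 2 + s')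
        = (\<Sum>(A, B)\<leftarrow>Ls i. sandwich a' A X r s * sandwich b B Y r' s')"
    by metis
  \<comment> \<open>One pair for each outcome \<open>i\<close>, each pair of the continuation
    \<open>\<Psi> i\<close> and each Kraus operator of \<open>E i\<close>. The instrument acts
    first, so \<open>K\<close> stands to the right of \<open>A\<close>.\<close>
  define Ls' where "Ls' = concat (map (\<lambda>i. concat (map (\<lambda>(A, B).
      map (\<lambda>K. (comp_op a' A K, B)) (Ks i)) (Ls i))) [0..<n])"
  show ?case
  proof (intro exI[of _ Ls'] ballI allI impI)
    fix X Y :: "complex mat" and r r' s s' :: nat
    assume X: "X \<in> carrier_mat a a" and Y: "Y \<in> carrier_mat b b"
      and lt: "r < 2" "r' < 2" "s < 2" "s' < 2"
    have branch: "\<Psi> i (act_left a a' b (E i) (kron X Y)) $$ (r * 2 + r', s * 2 + s')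
        = (\<Sum>(A, B)\<leftarrow>Ls i. \<Sum>K\<leftarrow>Ks i. sandwich a (comp_op a' A K) X r s * sandwich b B Y r' s')"
      if i: "i < n" for i
    proof -
      have lin: "linear_on a a' (E i)" using cp[OF i] by (simp add: completely_positive_def)
      then have EX: "E i X \<in> carrier_mat a' a'" using X by (simp add: linear_on_def)
      have "\<Psi> i (act_left a a' b (E i) (kron X Y)) $$ (r * 2 + r', s * 2 + s')
          = (\<Sum>(A, B)\<leftarrow>Ls i. sandwich a' A (E i X) r s * sandwich b B Y r' s')"
        unfolding act_left_kron[OF lin X Y] by (rule Ls[OF i EX Y lt])
      then show ?thesis
        by (simp add: sandwich_comp_op[OF Ks[OF i X]] sum_list_mult_const)
    qed
    have "family_sum (2 * 2) n (\<lambda>i X. \<Psi> i (act_left a a' b (E i) X)) (kron X Y)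
          $$ (r * 2 + r', s * 2 + s')
        = (\<Sum>i<n. \<Psi> i (act_left a a' b (E i) (kron X Y)) $$ (r * 2 + r', s * 2 + s'))"
      using lt by (simp add: family_sum_def)
    also have "\<dots> = (\<Sum>(A, B)\<leftarrow>Ls'. sandwich a A X r s * sandwich b B Y r' s')"
      by (simp add: branch Ls'_def sum_list_concat_map sum_list_upt split_def o_def)
    finally show "family_sum (2 * 2) n (\<lambda>i X. \<Psi> i (act_left a a' b (E i) X)) (kron X Y)
          $$ (r * 2 + r', s * 2 + s')
        = (\<Sum>(A, B)\<leftarrow>Ls'. sandwich a A X r s * sandwich b B Y r' s')" .
  qed
next
  case (right_party b b' n E a \<Psi>)
  have cp: "completely_positive b b' (E i)" if "i < n" for i
    using right_party.hyps that by (simp add: instrument_def)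
  have "\<forall>i. \<exists>Ks. i < n \<longrightarrow> (\<forall>X\<in>carrier_mat b b. \<forall>r<b'. \<forall>s<b'.
      E i X $$ (r, s) = (\<Sum>K\<leftarrow>Ks. sandwich b K X r s))"
    using kraus_decomposition[OF cp] by metis
  then obtain Ks where Ks: "\<And>i X r s. i < n \<Longrightarrow> X \<in> carrier_mat b b \<Longrightarrow> r < b' \<Longrightarrow> s < b' \<Longrightarrow>
      E i X $$ (r, s) = (\<Sum>K\<leftarrow>Ks i. sandwich b K X r s)"
    by metis
  from right_party.IH obtain Ls where Ls: "\<And>i X Y r r' s s'. i < n \<Longrightarrow> X \<in> carrier_mat a a \<Longrightarrow>
      Y \<in> carrier_mat b' b' \<Longrightarrow> r < 2 \<Longrightarrow> r' < 2 \<Longrightarrow> s < 2 \<Longrightarrow> s' < 2 \<Longrightarrow>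
      \<Psi> i (kron X Y) $$ (r * 2 + r', s * 2 + s')
        = (\<Sum>(A, B)\<leftarrow>Ls i. sandwich a A X r s * sandwich b' B Y r' s')"
    by metis
  define Ls' where "Ls' = concat (map (\<lambda>i. concat (map (\<lambda>(A, B).
      map (\<lambda>K. (A, comp_op b' B K)) (Ks i)) (Ls i))) [0..<n])"
  show ?case
  proof (intro exI[of _ Ls'] ballI allI impI)
    fix X Y :: "complex mat" and r r' s s' :: nat
    assume X: "X \<in> carrier_mat a a" and Y: "Y \<in> carrier_mat b b"
      and lt: "r < 2" "r' < 2" "s < 2" "s' < 2"
    have branch: "\<Psi> i (act_right a b b' (E i) (kron X Y)) $$ (r * 2 + r', s * 2 + s')
        = (\<Sum>(A, B)\<leftarrow>Ls i. \<Sum>K\<leftarrow>Ks i. sandwich a A X r s * sandwich b (comp_op b' B K) Y r' s')"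
      if i: "i < n" for i
    proof -
      have lin: "linear_on b b' (E i)" using cp[OF i] by (simp add: completely_positive_def)
      then have EY: "E i Y \<in> carrier_mat b' b'" using Y by (simp add: linear_on_def)
      have "\<Psi> i (act_right a b b' (E i) (kron X Y)) $$ (r * 2 + r', s * 2 + s')
          = (\<Sum>(A, B)\<leftarrow>Ls i. sandwich a A X r s * sandwich b' B (E i Y) r' s')"
        unfolding act_right_kron[OF lin X Y] by (rule Ls[OF i X EY lt])
      then show ?thesis
        by (simp add: sandwich_comp_op[OF Ks[OF i Y]] sum_list_const_mult)
    qed
    have "family_sum (2 * 2) n (\<lambda>i X. \<Psi> i (act_right a b b' (E i) X)) (kron X Y)
          $$ (r * 2 + r', s * 2 + s')
        = (\<Sum>i<n. \<Psi> i (act_right a b b' (E i) (kron X Y)) $$ (r * 2 + r', s * 2 + s'))"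
      using lt by (simp add: family_sum_def)
    also have "\<dots> = (\<Sum>(A, B)\<leftarrow>Ls'. sandwich a A X r s * sandwich b B Y r' s')"
      by (simp add: branch Ls'_def sum_list_concat_map sum_list_upt split_def o_def)
    finally show "family_sum (2 * 2) n (\<lambda>i X. \<Psi> i (act_right a b b' (E i) X)) (kron X Y)
          $$ (r * 2 + r', s * 2 + s')
        = (\<Sum>(A, B)\<leftarrow>Ls'. sandwich a A X r s * sandwich b B Y r' s')" .
  qed
qed

text \<open>
  Vectors and Kraus operators are functions of indices; only values below the dimension matter.
  A vector of \<open>\<complex>\<^sup>2 \<otimes> \<complex>\<^sup>2\<close> takes an index \<open>p * 2 + q\<close>, while \<open>tens A B u r s\<close> is the entry
  of \<open>(A \<otimes> B) u\<close> at \<open>e\<^sub>r \<otimes> e\<^sub>s\<close>.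
\<close>

definition outer_sum :: "(nat \<Rightarrow> complex) list \<Rightarrow> complex mat" where
  "outer_sum ws = mat (2 * 2) (2 * 2) (\<lambda>(i, j). \<Sum>w\<leftarrow>ws. w i * cnj (w j))"

definition tens ::
  "(nat \<Rightarrow> nat \<Rightarrow> complex) \<Rightarrow> (nat \<Rightarrow> nat \<Rightarrow> complex) \<Rightarrow> (nat \<Rightarrow> complex) \<Rightarrow> nat \<Rightarrow> nat \<Rightarrow> complex" where
  "tens A B u r s = (\<Sum>p<2. \<Sum>q<2. A r p * B s q * u (p * 2 + q))"

lemma tens_expand:
  "tens A B u r s = A r 0 * B s 0 * u 0 + A r 0 * B s 1 * u 1 + A r 1 * B s 0 * u 2 + A r 1 * B s 1 * u 3"
  by (simp add: tens_def numeral_2_eq_2 numeral_3_eq_3)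

section \<open>From product inputs to all inputs\<close>

lemma sum_list_swap:
  "(\<Sum>x\<leftarrow>xs. \<Sum>y\<leftarrow>ys. f x y) = (\<Sum>y\<leftarrow>ys. \<Sum>x\<leftarrow>xs. f x y)"
  for f :: "'a \<Rightarrow> 'b \<Rightarrow> 'c::comm_monoid_add"
  by (induction xs) (simp_all add: sum_list_addf)

lemma sandwich_unit_mat:
  assumes "i < d" "j < d"
  shows "sandwich d K (unit_mat d i j) r s = K r i * cnj (K s j)"
proof -
  have "(\<Sum>j'<d. K r i' * unit_mat d i j $$ (i', j') * cnj (K s j'))
      = (if i' = i then K r i * cnj (K s j) else 0)" if "i' < d" for i'
  proof -
    have "(\<Sum>j'<d. K r i' * unit_mat d i j $$ (i', j') * cnj (K s j'))
        = (\<Sum>j'<d. if j' = j then (if i' = i then K r i * cnj (K s j) else 0) else 0)"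
      using that by (intro sum.cong) (auto simp: unit_mat_def)
    then show ?thesis using assms by simp
  qed
  then have "sandwich d K (unit_mat d i j) r s = (\<Sum>i'<d. if i' = i then K r i * cnj (K s j) else 0)"
    by (simp add: sandwich_def)
  then show ?thesis using assms by simp
qed

text \<open>The matrix units of the composite system are products, so a formula known on products
  extends to every input by linearity.\<close>

lemma kron_unit_mat:
  assumes "i < m" "j < m" "i' < n" "j' < n"
  shows "kron (unit_mat m i j) (unit_mat n i' j') = unit_mat (m * n) (i * n + i') (j * n + j')"
proof (rule eq_matI)
  fix r c assume "r < dim_row (unit_mat (m * n) (i * n + i') (j * n + j'))"
    "c < dim_col (unit_mat (m * n) (i * n + i') (j * n + j'))"
  then have rc: "r < m * n" "c < m * n" by (simp_all add: unit_mat_def)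
  \<comment> \<open>Uniqueness of quotient and remainder on division by \<open>n\<close>.\<close>
  have eq: "r = i * n + i' \<longleftrightarrow> r div n = i \<and> r mod n = i'" if "i' < n" for r i i'
    using that by (metis add.commute add_cancel_right_left div_less div_mult_mod_eq div_mult_self1
        less_nat_zero_code mod_less mod_mult_self1)
  have "r div n < m" "c div n < m" "r mod n < n" "c mod n < n"
    using rc assms by (simp_all add: less_mult_imp_div_less)
  then show "kron (unit_mat m i j) (unit_mat n i' j') $$ (r, c)
      = unit_mat (m * n) (i * n + i') (j * n + j') $$ (r, c)"
    using rc eq[OF assms(3), of r i] eq[OF assms(4), of c j] by (simp add: kron_def unit_mat_def)
qed (simp_all add: kron_def unit_mat_def)

text \<open>The first property expands the input in matrix units, each of which is a product. The
  second is trace preservation evaluated at the rank-one input built from \<open>w\<close>, that is,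
  the completeness relation of the Kraus operators as a quadratic form.\<close>

lemma locc_map_kraus:
  assumes "locc_map \<Lambda>"
  obtains Ls where
    "\<And>ws r r' s s'. r < 2 \<Longrightarrow> r' < 2 \<Longrightarrow> s < 2 \<Longrightarrow> s' < 2 \<Longrightarrow>
      \<Lambda> (outer_sum ws) $$ (r * 2 + r', s * 2 + s')
        = (\<Sum>w\<leftarrow>ws. \<Sum>(A, B)\<leftarrow>Ls. tens A B w r r' * cnj (tens A B w s s'))"
    and "\<And>w. (\<Sum>(A, B)\<leftarrow>Ls. \<Sum>r<2. \<Sum>s<2. (cmod (tens A B w r s))\<^sup>2) = (\<Sum>p<4. (cmod (w p))\<^sup>2)"
proof -
  have lin: "linear_on (2 * 2) (2 * 2) \<Lambda>" and tp: "trace_preserving (2 * 2) \<Lambda>"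
    using assms by (auto simp: locc_map_def completely_positive_def)
  have "locc_protocol 2 2 \<Lambda>" using assms by (simp add: locc_map_def)
  from locc_protocol_product_kraus[OF this] obtain Ls where
    Ls: "\<And>X Y r r' s s'. X \<in> carrier_mat 2 2 \<Longrightarrow> Y \<in> carrier_mat 2 2 \<Longrightarrow>
      r < 2 \<Longrightarrow> r' < 2 \<Longrightarrow> s < 2 \<Longrightarrow> s' < 2 \<Longrightarrow>
      \<Lambda> (kron X Y) $$ (r * 2 + r', s * 2 + s')
        = (\<Sum>(A, B)\<leftarrow>Ls. sandwich 2 A X r s * sandwich 2 B Y r' s')"
    by metis
  have one: "\<Lambda> (outer_sum ws) $$ (r * 2 + r', s * 2 + s')
        = (\<Sum>w\<leftarrow>ws. \<Sum>(A, B)\<leftarrow>Ls. tens A B w r r' * cnj (tens A B w s s'))"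
    if lt: "r < 2" "r' < 2" "s < 2" "s' < 2" for ws r r' s s'
  proof -
    have E: "\<Lambda> (unit_mat (2 * 2) (i * 2 + i') (j * 2 + j')) $$ (r * 2 + r', s * 2 + s')
        = (\<Sum>(A, B)\<leftarrow>Ls. A r i * B r' i' * cnj (A s j * B s' j'))"
      if "i < 2" "i' < 2" "j < 2" "j' < 2" for i i' j j'
      unfolding kron_unit_mat[OF that(1,3,2,4), symmetric] Ls[OF unit_mat_carrier unit_mat_carrier lt]
        sandwich_unit_mat[OF that(1,3)] sandwich_unit_mat[OF that(2,4)]
      by (simp add: mult_ac)
    have square: "(\<Sum>i<2. \<Sum>i'<2. \<Sum>j<2. \<Sum>j'<2.
        (A r i * B r' i' * w (i * 2 + i')) * cnj (A s j * B s' j' * w (j * 2 + j')))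
        = tens A B w r r' * cnj (tens A B w s s')" for A B w
      unfolding tens_def cnj_sum sum_distrib_left sum_distrib_right by (rule sum_swap_pairs)
    have "\<Lambda> (outer_sum ws) $$ (r * 2 + r', s * 2 + s') = (\<Sum>i<2. \<Sum>i'<2. \<Sum>j<2. \<Sum>j'<2.
        (\<Sum>w\<leftarrow>ws. w (i * 2 + i') * cnj (w (j * 2 + j')))
        * (\<Sum>(A, B)\<leftarrow>Ls. A r i * B r' i' * cnj (A s j * B s' j')))"
      using lt by (subst linear_on_expand[OF lin])
        (simp_all add: outer_sum_def sum_lessThan_mult E del: mult_2 mult_2_right mult_numeral_1_right arith_simps)
    also have "\<dots> = (\<Sum>w\<leftarrow>ws. \<Sum>(A, B)\<leftarrow>Ls. \<Sum>i<2. \<Sum>i'<2. \<Sum>j<2. \<Sum>j'<2.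
        (A r i * B r' i' * w (i * 2 + i')) * cnj (A s j * B s' j' * w (j * 2 + j')))"
      by (simp add: sum_list_const_mult[symmetric] sum_list_mult_const[symmetric] sum_list_sum_swap split_def mult_ac)
        (rule sum_list_swap)
    also have "\<dots> = (\<Sum>w\<leftarrow>ws. \<Sum>(A, B)\<leftarrow>Ls. tens A B w r r' * cnj (tens A B w s s'))"
      by (simp only: square)
    finally show ?thesis .
  qed
  moreover have "(\<Sum>(A, B)\<leftarrow>Ls. \<Sum>r<2. \<Sum>s<2. (cmod (tens A B w r s))\<^sup>2) = (\<Sum>p<4. (cmod (w p))\<^sup>2)" for w
  proof -
    have sq: "z * cnj z = (complex_of_real (cmod z))\<^sup>2" for z
      using complex_norm_square[of z] by simp
    have "outer_sum [w] \<in> carrier_mat (2 * 2) (2 * 2)" by (simp add: outer_sum_def)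
    then have "mat_trace (\<Lambda> (outer_sum [w])) = mat_trace (outer_sum [w])"
      and "\<Lambda> (outer_sum [w]) \<in> carrier_mat (2 * 2) (2 * 2)"
      using tp lin unfolding trace_preserving_def linear_on_def by blast+
    then have "(\<Sum>p<2 * 2. \<Lambda> (outer_sum [w]) $$ (p, p)) = (\<Sum>p<2 * 2. outer_sum [w] $$ (p, p))"
      by (simp add: mat_trace_def outer_sum_def)
    also have "(\<Sum>p<2 * 2. outer_sum [w] $$ (p, p)) = of_real (\<Sum>p<4. (cmod (w p))\<^sup>2)"
      by (simp add: outer_sum_def sq)
    also have "(\<Sum>p<2 * 2. \<Lambda> (outer_sum [w]) $$ (p, p))
        = (\<Sum>r<2. \<Sum>s<2. \<Sum>(A, B)\<leftarrow>Ls. tens A B w r s * cnj (tens A B w r s))"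
      unfolding sum_lessThan_mult by (simp add: one)
    also have "\<dots> = (\<Sum>(A, B)\<leftarrow>Ls. of_real (\<Sum>r<2. \<Sum>s<2. (cmod (tens A B w r s))\<^sup>2))"
      by (simp add: sum_list_sum_swap sq split_def)
    also have "\<dots> = of_real (\<Sum>(A, B)\<leftarrow>Ls. \<Sum>r<2. \<Sum>s<2. (cmod (tens A B w r s))\<^sup>2)"
      by (induction Ls) auto
    finally show ?thesis unfolding of_real_eq_iff .
  qed
  ultimately show ?thesis by (rule that)
qed

section \<open>Amplitudes in a product basis\<close>

definition prod_vec :: "(nat \<Rightarrow> complex) \<Rightarrow> (nat \<Rightarrow> complex) \<Rightarrow> nat \<Rightarrow> complex" where
  "prod_vec f g p = f (p div 2) * g (p mod 2)"

text \<open>A vector orthogonal to \<open>f\<close> and of the same norm; for a unit vector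
  \<open>f\<close> the two form an orthonormal basis of the qubit space.\<close>

definition perp :: "(nat \<Rightarrow> complex) \<Rightarrow> nat \<Rightarrow> complex" where
  "perp f p = (if p = 0 then - cnj (f 1) else cnj (f 0))"

text \<open>The inner product of \<open>u\<close> with f tensor g, conjugate linear in the product
  vector.\<close>

definition coord :: "(nat \<Rightarrow> complex) \<Rightarrow> (nat \<Rightarrow> complex) \<Rightarrow> (nat \<Rightarrow> complex) \<Rightarrow> complex" where
  "coord f g u = (\<Sum>p<4. cnj (prod_vec f g p) * u p)"

definition qubit_app :: "(nat \<Rightarrow> nat \<Rightarrow> complex) \<Rightarrow> (nat \<Rightarrow> complex) \<Rightarrow> nat \<Rightarrow> complex" where
  "qubit_app A f r = A r 0 * f 0 + A r 1 * f 1"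

lemma sum_lessThan_4: "(\<Sum>p<4. F p) = F 0 + F 1 + F 2 + F (3::nat)"
  for F :: "nat \<Rightarrow> 'a::comm_monoid_add"
  by (simp add: eval_nat_numeral add.assoc)

lemma tens_prod_vec: "tens A B (prod_vec f g) r s = qubit_app A f r * qubit_app B g s"
  by (simp add: tens_expand prod_vec_def qubit_app_def algebra_simps)

lemma unit_qubit: "(cmod (f 0))\<^sup>2 + (cmod (f 1))\<^sup>2 = 1 \<Longrightarrow> f 0 * cnj (f 0) + f 1 * cnj (f 1) = 1"
  for f :: "nat \<Rightarrow> complex"
  by (metis complex_norm_square of_real_1 of_real_add)

text \<open>The four products of \<open>f\<close>, \<open>perp f\<close> with \<open>g\<close>,
  \<open>perp g\<close> form an orthonormal basis. In coordinates the right-hand side is the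
  left-hand side times the squared norms of \<open>f\<close> and \<open>g\<close>, both 1.\<close>

lemma tens_basis_expansion:
  assumes "(cmod (f 0))\<^sup>2 + (cmod (f 1))\<^sup>2 = 1" "(cmod (g 0))\<^sup>2 + (cmod (g 1))\<^sup>2 = 1"
  shows "tens A B u r s = coord f g u * (qubit_app A f r * qubit_app B g s)
      + coord f (perp g) u * (qubit_app A f r * qubit_app B (perp g) s)
      + coord (perp f) g u * (qubit_app A (perp f) r * qubit_app B g s)
      + coord (perp f) (perp g) u * (qubit_app A (perp f) r * qubit_app B (perp g) s)" (is "_ = ?rhs")
proof -
  have "?rhs = (f 0 * cnj (f 0) + f 1 * cnj (f 1)) * (g 0 * cnj (g 0) + g 1 * cnj (g 1)) * tens A B u r s"
    by (simp add: tens_expand coord_def sum_lessThan_4 prod_vec_def perp_def qubit_app_def algebra_simps)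
  then show ?thesis using assms[THEN unit_qubit] by simp
qed

text \<open>Parseval for the four product basis vectors, with two nonnegative terms dropped.\<close>

lemma bessel_two:
  assumes "(cmod (f 0))\<^sup>2 + (cmod (f 1))\<^sup>2 = 1" "(cmod (g 0))\<^sup>2 + (cmod (g 1))\<^sup>2 = 1"
  shows "(cmod (coord f (perp g) u))\<^sup>2 + (cmod (coord (perp f) g u))\<^sup>2 \<le> (\<Sum>p<4. (cmod (u p))\<^sup>2)"
proof -
  define S where "S = (\<Sum>p<4. (cmod (u p))\<^sup>2)"
  define N where "N z = complex_of_real ((cmod z)\<^sup>2)" for z
  have N: "N z = z * cnj z" for z by (simp only: N_def complex_norm_square)
  have S: "complex_of_real S = u 0 * cnj (u 0) + u 1 * cnj (u 1) + u 2 * cnj (u 2) + u 3 * cnj (u 3)"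
    unfolding S_def sum_lessThan_4 of_real_add N_def[symmetric] N ..
  have "N (coord f g u) + N (coord f (perp g) u) + N (coord (perp f) g u) + N (coord (perp f) (perp g) u)
      = (f 0 * cnj (f 0) + f 1 * cnj (f 1)) * (g 0 * cnj (g 0) + g 1 * cnj (g 1)) * of_real S"
    unfolding N S by (simp add: coord_def sum_lessThan_4 prod_vec_def perp_def algebra_simps)
  also have "\<dots> = of_real S" using assms[THEN unit_qubit] by simp
  finally have "(cmod (coord f g u))\<^sup>2 + (cmod (coord f (perp g) u))\<^sup>2 + (cmod (coord (perp f) g u))\<^sup>2
      + (cmod (coord (perp f) (perp g) u))\<^sup>2 = S"
    unfolding N_def of_real_add[symmetric] of_real_eq_iff .
  moreover have "0 \<le> (cmod (coord f g u))\<^sup>2" "0 \<le> (cmod (coord (perp f) (perp g) u))\<^sup>2" by simp_all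
  ultimately show ?thesis unfolding S_def by linarith
qed

lemma norm_prod_vec: "(\<Sum>p<4. (cmod (prod_vec f g p))\<^sup>2)
    = ((cmod (f 0))\<^sup>2 + (cmod (f 1))\<^sup>2) * ((cmod (g 0))\<^sup>2 + (cmod (g 1))\<^sup>2)"
  by (simp add: sum_lessThan_4 prod_vec_def norm_mult power_mult_distrib algebra_simps)

lemma norm_perp: "(cmod (perp f 0))\<^sup>2 + (cmod (perp f 1))\<^sup>2 = (cmod (f 0))\<^sup>2 + (cmod (f 1))\<^sup>2"
  by (simp add: perp_def add.commute)

text \<open>
  Here \<open>\<alpha>\<close>, \<open>\<beta>\<close>, \<open>\<gamma>\<close>, \<open>\<delta>\<close> are \<open>A f\<close>, \<open>B g\<close>, \<open>A f\<^sup>\<bottom>\<close>, \<open>B g\<^sup>\<bottom>\<close>.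
  If \<open>A f\<close> or \<open>B g\<close> vanishes then \<open>T\<close> is a product, which is no nonzero multiple of \<open>\<chi>\<close>.
\<close>

lemma branch_amplitudes:
  fixes a b :: complex and \<alpha> \<beta> \<gamma> \<delta> :: "nat \<Rightarrow> complex"
  assumes "\<alpha> 0 * \<beta> 1 = 0" "\<alpha> 1 * \<beta> 0 = 0" "\<alpha> 1 * \<beta> 1 = 0"
    and T: "\<And>r s. T r s = w * (\<alpha> r * \<beta> s) + x * (\<alpha> r * \<delta> s) + y * (\<gamma> r * \<beta> s) + z * (\<gamma> r * \<delta> s)"
    and T11: "T 1 1 = 0" and ratio: "b * T 0 1 = a * T 1 0" and ab: "a \<noteq> 0" "b \<noteq> 0"
  shows "T 0 1 = 0 \<and> T 1 0 = 0 \<or> T 0 1 = x * (\<alpha> 0 * \<delta> 1) \<and> T 1 0 = y * (\<gamma> 1 * \<beta> 0)"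
proof (cases "T 0 1 = 0 \<or> T 1 0 = 0")
  case True
  then show ?thesis using ratio ab by auto
next
  case False
  show ?thesis
  proof (cases "(\<alpha> 0 = 0 \<and> \<alpha> 1 = 0) \<or> (\<beta> 0 = 0 \<and> \<beta> 1 = 0)")
    case True
    then have "T 0 1 * T 1 0 = T 0 0 * T 1 1"
      by (auto simp: T algebra_simps)
    then show ?thesis using False T11 by simp
  next
    case nz: False
    \<comment> \<open>Both vectors are nonzero, so the three vanishing products force them to be
      multiples of the first basis vector.\<close>
    then have "\<alpha> 1 = 0" "\<beta> 1 = 0" using assms(1-3) by auto
    then have "z * (\<gamma> 1 * \<delta> 1) = 0" "T 0 1 = x * (\<alpha> 0 * \<delta> 1) + z * (\<gamma> 0 * \<delta> 1)"
      "T 1 0 = y * (\<gamma> 1 * \<beta> 0) + z * (\<gamma> 1 * \<delta> 0)"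
      using T11 by (simp_all add: T)
    \<comment> \<open>Of the factors of \<open>z * (\<gamma> 1 * \<delta> 1)\<close>, the second
      being zero would give \<open>T 1 0 = 0\<close> and the third \<open>T 0 1 = 0\<close>; both
      are excluded, so \<open>z = 0\<close>.\<close>
    then show ?thesis using False by auto
  qed
qed

section \<open>Reaching the target states\<close>

text \<open>Index 1 is e01 and index 2 is e10. For \<open>a\<^sup>2 + b\<^sup>2 = 1\<close> this is
  half the projection onto the span of e00 and a e01 + b e10.\<close>

definition target :: "real \<Rightarrow> real \<Rightarrow> complex mat" where
  "target a b = outer_sum [\<lambda>p. of_bool (p = 0) / sqrt 2,
     \<lambda>p. complex_of_real (if p = 1 then a else if p = 2 then b else 0) / sqrt 2]"

lemma target_entries:
  "target a b $$ (3, 3) = 0" "target a b $$ (1, 1) = of_real (a\<^sup>2 / 2)"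
  "target a b $$ (2, 2) = of_real (b\<^sup>2 / 2)" "target a b $$ (1, 2) = of_real (a * b / 2)"
  "target a b $$ (2, 1) = of_real (a * b / 2)"
proof -
  have "complex_of_real (sqrt 2) * complex_of_real (sqrt 2) = 2"
    by (simp flip: of_real_mult)
  then show "target a b $$ (3, 3) = 0" "target a b $$ (1, 1) = of_real (a\<^sup>2 / 2)"
    "target a b $$ (2, 2) = of_real (b\<^sup>2 / 2)" "target a b $$ (1, 2) = of_real (a * b / 2)"
    "target a b $$ (2, 1) = of_real (a * b / 2)"
    by (simp_all add: target_def outer_sum_def power2_eq_square mult.commute)
qed

lemma of_real_sum_list: "of_real (\<Sum>x\<leftarrow>xs. f x) = (\<Sum>x\<leftarrow>xs. complex_of_real (f x))"
  by (induction xs) simp_all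

lemma nested_sum_list_zero:
  fixes h :: "'a \<Rightarrow> 'b \<Rightarrow> 'c \<Rightarrow> real"
  assumes "(\<Sum>x\<leftarrow>xs. \<Sum>(A, B)\<leftarrow>Ls. h x A B) = 0" "\<And>x A B. 0 \<le> h x A B"
    and "x \<in> set xs" "(A, B) \<in> set Ls"
  shows "h x A B = 0"
proof -
  have "0 \<le> (\<Sum>(A, B)\<leftarrow>Ls. h x A B)" for x
    using assms(2) by (intro sum_list_nonneg) auto
  then have "(\<Sum>(A, B)\<leftarrow>Ls. h x A B) = 0"
    using assms(1,3) by (subst (asm) sum_list_nonneg_eq_0_iff) auto
  then show ?thesis
    using assms(2,4) by (subst (asm) sum_list_nonneg_eq_0_iff) auto
qed

text \<open>Every branch maps every input vector into the range of the target. This confines the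
  amplitude at e01 to what comes from f tensor \<open>perp g\<close>, and that at e10 to what comes
  from \<open>perp f\<close> tensor g; completeness of the Kraus operators then bounds the diagonal
  entries of the target by the weights of these components.\<close>

lemma locc_to_target_bounds:
  assumes "locc_map \<Lambda>" and \<Lambda>: "\<Lambda> (outer_sum ((\<lambda>p. c * prod_vec f g p) # us)) = target a b"
    and f: "(cmod (f 0))\<^sup>2 + (cmod (f 1))\<^sup>2 = 1" and g: "(cmod (g 0))\<^sup>2 + (cmod (g 1))\<^sup>2 = 1"
    and c: "c \<noteq> 0" and ab: "a \<noteq> 0" "b \<noteq> 0"
  shows "a\<^sup>2 / 2 \<le> (\<Sum>u\<leftarrow>us. (cmod (coord f (perp g) u))\<^sup>2)"
    and "b\<^sup>2 / 2 \<le> (\<Sum>u\<leftarrow>us. (cmod (coord (perp f) g u))\<^sup>2)"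
proof -
  define w0 where "w0 = (\<lambda>p. c * prod_vec f g p)"
  define ws where "ws = w0 # us"
  from \<open>locc_map \<Lambda>\<close> obtain Ls where
    Ls: "\<And>ws r r' s s'. r < 2 \<Longrightarrow> r' < 2 \<Longrightarrow> s < 2 \<Longrightarrow> s' < 2 \<Longrightarrow>
      \<Lambda> (outer_sum ws) $$ (r * 2 + r', s * 2 + s')
        = (\<Sum>w\<leftarrow>ws. \<Sum>(A, B)\<leftarrow>Ls. tens A B w r r' * cnj (tens A B w s s'))"
    and tp: "\<And>w. (\<Sum>(A, B)\<leftarrow>Ls. \<Sum>r<2. \<Sum>s<2. (cmod (tens A B w r s))\<^sup>2) = (\<Sum>p<4. (cmod (w p))\<^sup>2)"
    using locc_map_kraus by blast
  have S: "(\<Sum>w\<leftarrow>ws. \<Sum>(A, B)\<leftarrow>Ls. tens A B w r r' * cnj (tens A B w s s'))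
      = target a b $$ (r * 2 + r', s * 2 + s')"
    if "r < 2" "r' < 2" "s < 2" "s' < 2" for r r' s s'
    using Ls[OF that, of ws] \<Lambda> by (simp add: ws_def w0_def)
  have sq: "complex_of_real (\<Sum>w\<leftarrow>ws. \<Sum>(A, B)\<leftarrow>Ls. (cmod (tens A B w r r'))\<^sup>2)
      = (\<Sum>w\<leftarrow>ws. \<Sum>(A, B)\<leftarrow>Ls. tens A B w r r' * cnj (tens A B w r r'))" for r r'
    by (simp only: of_real_sum_list split_def complex_norm_square)
  have T11: "tens A B w 1 1 = 0" if "w \<in> set ws" "(A, B) \<in> set Ls" for w A B
  \<comment> \<open>The diagonal entry of the target at e11 is zero and is a sum of squared moduli
    over all vectors and branches.\<close>
  proof -
    have "(\<Sum>w\<leftarrow>ws. \<Sum>(A, B)\<leftarrow>Ls. (cmod (tens A B w 1 1))\<^sup>2) = 0"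
      using sq[of 1 1] S[of 1 1 1 1] target_entries(1)[of a b] by simp
    from nested_sum_list_zero[OF this _ that] show ?thesis by simp
  qed
  have ratio: "b * tens A B w 0 1 = a * tens A B w 1 0" if "w \<in> set ws" "(A, B) \<in> set Ls" for w A B
  proof -
    \<comment> \<open>The vector b e01 - a e10 lies in the kernel of the target. Its expectation
      value is the sum of these squared moduli, so each of them vanishes.\<close>
    have expand: "complex_of_real ((cmod (b * T - a * T'))\<^sup>2) = of_real (b\<^sup>2) * (T * cnj T)
        + of_real (a\<^sup>2) * (T' * cnj T') - of_real (a * b) * (T * cnj T')
        - of_real (a * b) * (T' * cnj T)" for T T' :: complex
      unfolding complex_norm_square by (simp add: power2_eq_square algebra_simps)
    have "complex_of_real (\<Sum>w\<leftarrow>ws. \<Sum>(A, B)\<leftarrow>Ls. (cmod (b * tens A B w 0 1 - a * tens A B w 1 0))\<^sup>2)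
      = of_real (b\<^sup>2) * target a b $$ (1, 1) + of_real (a\<^sup>2) * target a b $$ (2, 2)
        - of_real (a * b) * target a b $$ (1, 2) - of_real (a * b) * target a b $$ (2, 1)"
      using S[of 0 1 0 1] S[of 1 0 1 0] S[of 0 1 1 0] S[of 1 0 0 1]
      unfolding of_real_sum_list expand split_def sum_list_addf sum_list_subtractf sum_list_const_mult
      by simp
    also have "\<dots> = 0"
      unfolding target_entries by (simp add: power2_eq_square)
    finally have "(\<Sum>w\<leftarrow>ws. \<Sum>(A, B)\<leftarrow>Ls. (cmod (b * tens A B w 0 1 - a * tens A B w 1 0))\<^sup>2) = 0"
      by (simp only: of_real_eq_0_iff)
    from nested_sum_list_zero[OF this _ that] show ?thesis by simp
  qed
  have T: "tens A B w0 r s = c * (qubit_app A f r * qubit_app B g s)" for A B r s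
    by (simp add: w0_def tens_prod_vec[symmetric] tens_expand algebra_simps)
  have w0: "qubit_app A f 0 * qubit_app B g 1 = 0 \<and> qubit_app A f 1 * qubit_app B g 0 = 0 \<and> qubit_app A f 1 * qubit_app B g 1 = 0"
    if L: "(A, B) \<in> set Ls" for A B
  proof -
    have "w0 \<in> set ws" by (simp add: ws_def)
    \<comment> \<open>The image of \<open>w0\<close> is a product. Its amplitude at e11 is zero, so
      one of those at e01 and e10 is zero, and by \<open>ratio\<close> so is the other.\<close>
    from T11[OF this L] ratio[OF this L] c ab show ?thesis
      unfolding T by auto
  qed
  have w0_zero: "tens A B w0 0 1 = 0" "tens A B w0 1 0 = 0" if "(A, B) \<in> set Ls" for A B
    using w0[OF that] by (simp_all add: T)
  have amp: "tens A B u 0 1 = 0 \<and> tens A B u 1 0 = 0 \<or>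
      tens A B u 0 1 = coord f (perp g) u * (qubit_app A f 0 * qubit_app B (perp g) 1) \<and>
      tens A B u 1 0 = coord (perp f) g u * (qubit_app A (perp f) 1 * qubit_app B g 0)"
    if u: "u \<in> set us" and L: "(A, B) \<in> set Ls" for u A B
  proof -
    have u': "u \<in> set ws" using u by (simp add: ws_def)
    show ?thesis
      using w0[OF L] T11[OF u' L] ratio[OF u' L] ab
      by (intro branch_amplitudes[OF _ _ _ tens_basis_expansion[OF f g]]) auto
  qed
  \<comment> \<open>Stated for a general unit product vector, to serve both inequalities. In each
    branch the amplitude is zero or a coordinate of \<open>u\<close> times an amplitude of the image
    of f' tensor g'; the squared norms of these images sum to 1 over all branches.\<close>
  have bound: "(\<Sum>u\<leftarrow>us. \<Sum>(A, B)\<leftarrow>Ls. (cmod (tens A B u r s))\<^sup>2) \<le> (\<Sum>u\<leftarrow>us. (cmod (coord f' g' u))\<^sup>2)"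
    if rs: "r < 2" "s < 2" and f': "(cmod (f' 0))\<^sup>2 + (cmod (f' 1))\<^sup>2 = 1"
      and g': "(cmod (g' 0))\<^sup>2 + (cmod (g' 1))\<^sup>2 = 1"
      and amp': "\<And>u A B. u \<in> set us \<Longrightarrow> (A, B) \<in> set Ls \<Longrightarrow>
        tens A B u r s = 0 \<or> tens A B u r s = coord f' g' u * (qubit_app A f' r * qubit_app B g' s)"
    for r s f' g'
  proof (rule sum_list_mono)
    fix u assume u: "u \<in> set us"
    have "(\<Sum>(A, B)\<leftarrow>Ls. (cmod (tens A B u r s))\<^sup>2)
        \<le> (\<Sum>(A, B)\<leftarrow>Ls. (cmod (coord f' g' u))\<^sup>2 * (\<Sum>r<2. \<Sum>s<2. (cmod (tens A B (prod_vec f' g') r s))\<^sup>2))"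
    proof (rule sum_list_mono, clarify)
      fix A B assume L: "(A, B) \<in> set Ls"
      have "(cmod (tens A B u r s))\<^sup>2
          \<le> (cmod (coord f' g' u))\<^sup>2 * (cmod (tens A B (prod_vec f' g') r s))\<^sup>2"
        using amp'[OF u L] by (auto simp: tens_prod_vec norm_mult power_mult_distrib)
      also have "(cmod (tens A B (prod_vec f' g') r s))\<^sup>2 \<le> (\<Sum>s<2. (cmod (tens A B (prod_vec f' g') r s))\<^sup>2)"
        using rs by (intro member_le_sum) auto
      also have "\<dots> \<le> (\<Sum>r<2. \<Sum>s<2. (cmod (tens A B (prod_vec f' g') r s))\<^sup>2)"
        using rs by (intro member_le_sum[of r "{..<2}" "\<lambda>r. \<Sum>s<2. (cmod (tens A B (prod_vec f' g') r s))\<^sup>2"])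
          (auto intro: sum_nonneg)
      finally show "(cmod (tens A B u r s))\<^sup>2 \<le> (cmod (coord f' g' u))\<^sup>2
          * (\<Sum>r<2. \<Sum>s<2. (cmod (tens A B (prod_vec f' g') r s))\<^sup>2)"
        by (simp add: mult_left_mono)
    qed
    also have "\<dots> = (cmod (coord f' g' u))\<^sup>2"
      unfolding split_def sum_list_const_mult
      using tp[of "prod_vec f' g'"] f' g' by (simp add: norm_prod_vec split_def)
    finally show "(\<Sum>(A, B)\<leftarrow>Ls. (cmod (tens A B u r s))\<^sup>2) \<le> (cmod (coord f' g' u))\<^sup>2" .
  qed
  \<comment> \<open>The product component \<open>w0\<close> contributes nothing at e01 and e10, so
    these entries of the target come from \<open>us\<close> alone.\<close>
  have drop: "(\<Sum>w\<leftarrow>ws. \<Sum>(A, B)\<leftarrow>Ls. (cmod (tens A B w r s))\<^sup>2)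
      = (\<Sum>u\<leftarrow>us. \<Sum>(A, B)\<leftarrow>Ls. (cmod (tens A B u r s))\<^sup>2)"
    if "\<And>A B. (A, B) \<in> set Ls \<Longrightarrow> tens A B w0 r s = 0" for r s
  proof -
    have "(\<Sum>(A, B)\<leftarrow>Ls. (cmod (tens A B w0 r s))\<^sup>2) = (\<Sum>(A, B)\<leftarrow>Ls. 0)"
      using that by (intro arg_cong[of _ _ sum_list] map_cong) auto
    then show ?thesis by (simp add: ws_def split_def)
  qed
  have "complex_of_real (\<Sum>w\<leftarrow>ws. \<Sum>(A, B)\<leftarrow>Ls. (cmod (tens A B w 0 1))\<^sup>2) = of_real (a\<^sup>2 / 2)"
    unfolding sq using S[of 0 1 0 1] target_entries(2)[of a b] by simp
  then have "a\<^sup>2 / 2 = (\<Sum>u\<leftarrow>us. \<Sum>(A, B)\<leftarrow>Ls. (cmod (tens A B u 0 1))\<^sup>2)"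
    using drop[of 0 1] w0_zero(1) by (simp only: of_real_eq_iff)
  also have "\<dots> \<le> (\<Sum>u\<leftarrow>us. (cmod (coord f (perp g) u))\<^sup>2)"
    using f g amp by (intro bound) (auto simp: norm_perp[unfolded One_nat_def])
  finally show "a\<^sup>2 / 2 \<le> (\<Sum>u\<leftarrow>us. (cmod (coord f (perp g) u))\<^sup>2)" .
  have "complex_of_real (\<Sum>w\<leftarrow>ws. \<Sum>(A, B)\<leftarrow>Ls. (cmod (tens A B w 1 0))\<^sup>2) = of_real (b\<^sup>2 / 2)"
    unfolding sq using S[of 1 0 1 0] target_entries(3)[of a b] by simp
  then have "b\<^sup>2 / 2 = (\<Sum>u\<leftarrow>us. \<Sum>(A, B)\<leftarrow>Ls. (cmod (tens A B u 1 0))\<^sup>2)"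
    using drop[of 1 0] w0_zero(2) by (simp only: of_real_eq_iff)
  also have "\<dots> \<le> (\<Sum>u\<leftarrow>us. (cmod (coord (perp f) g u))\<^sup>2)"
    using f g amp by (intro bound) (auto simp: norm_perp[unfolded One_nat_def])
  finally show "b\<^sup>2 / 2 \<le> (\<Sum>u\<leftarrow>us. (cmod (coord (perp f) g u))\<^sup>2)" .
qed

section \<open>The spectrum of the target states\<close>

lemma mult_mat_4:
  assumes "A \<in> carrier_mat 4 4" "B \<in> carrier_mat 4 4" "i < 4" "j < 4"
  shows "(A * B) $$ (i, j) = A $$ (i, 0) * B $$ (0, j) + A $$ (i, 1) * B $$ (1, j)
    + A $$ (i, 2) * B $$ (2, j) + A $$ (i, 3) * B $$ (3, j)"
proof -
  have "(A * B) $$ (i, j) = (\<Sum>k<4. A $$ (i, k) * B $$ (k, j))"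
    using assms by (simp add: scalar_prod_def atLeast0LessThan)
  then show ?thesis by (simp add: sum_lessThan_4)
qed

lemma less_4_cases: "i < (4::nat) \<longleftrightarrow> i = 0 \<or> i = 1 \<or> i = 2 \<or> i = 3"
  by auto

lemma target_char_poly:
  assumes "a\<^sup>2 + b\<^sup>2 = 1"
  shows "char_poly (target a b) = (\<Prod>e\<leftarrow>[1 / 2, 1 / 2, 0, 0]. [:- e, 1:])"
proof -
  have ab: "complex_of_real a * complex_of_real a + complex_of_real b * complex_of_real b = 1"
    using assms by (metis of_real_1 of_real_add of_real_mult power2_eq_square)
  have s: "complex_of_real (sqrt 2) * complex_of_real (sqrt 2) = 2"
    by (simp flip: of_real_mult)
  \<comment> \<open>Orthonormal eigenvectors as columns: e00, a e01 + b e10, - b e01 + a e10 and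
    e11.\<close>
  define P :: "complex mat" where "P = mat 4 4 (\<lambda>(i, j).
    [[1, 0, 0, 0], [0, a, - b, 0], [0, b, a, 0], [0, 0, 0, 1]] ! i ! j)"
  define D :: "complex mat" where "D = mat 4 4 (\<lambda>(i, j).
    if i = j then [1 / 2, 1 / 2, 0, 0] ! i else 0)"
  have carr: "P \<in> carrier_mat 4 4" "D \<in> carrier_mat 4 4" "transpose_mat P \<in> carrier_mat 4 4"
    "target a b \<in> carrier_mat 4 4"
    by (simp_all add: P_def D_def target_def outer_sum_def)
  have PD: "P * D \<in> carrier_mat 4 4" using carr by simp
  have P: "P $$ (i, j) = complex_of_real ([[1, 0, 0, 0], [0, a, - b, 0], [0, b, a, 0], [0, 0, 0, 1]] ! i ! j)"
    if "i < 4" "j < 4" for i j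
    using that by (simp add: P_def)
  have PT: "transpose_mat P $$ (i, j) = P $$ (j, i)" if "i < 4" "j < 4" for i j
    using that by (simp add: P_def)
  have PD_entry: "(P * D) $$ (i, k) = P $$ (i, k) * [1 / 2, 1 / 2, 0, 0] ! k" if "i < 4" "k < 4" for i k
    using that(2) unfolding mult_mat_4[OF carr(1,2) that] less_4_cases
    by (elim disjE; simp add: D_def)
  have "P * transpose_mat P = 1\<^sub>m 4"
  proof (rule eq_matI)
    fix i j :: nat assume "i < dim_row (1\<^sub>m 4 :: complex mat)" "j < dim_col (1\<^sub>m 4 :: complex mat)"
    then have ij: "i < 4" "j < 4" by simp_all
    then show "(P * transpose_mat P) $$ (i, j) = 1\<^sub>m 4 $$ (i, j)"
      using ab unfolding mult_mat_4[OF carr(1,3) ij] less_4_cases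
      by (elim disjE; simp add: P_def add.commute)
  qed (use carr in auto)
  moreover have "transpose_mat P * P = 1\<^sub>m 4"
  proof (rule eq_matI)
    fix i j :: nat assume "i < dim_row (1\<^sub>m 4 :: complex mat)" "j < dim_col (1\<^sub>m 4 :: complex mat)"
    then have ij: "i < 4" "j < 4" by simp_all
    then show "(transpose_mat P * P) $$ (i, j) = 1\<^sub>m 4 $$ (i, j)"
      using ab unfolding mult_mat_4[OF carr(3,1) ij] less_4_cases
      by (elim disjE; simp add: P_def add.commute)
  qed (use carr in auto)
  moreover have "target a b = P * D * transpose_mat P"
  proof (rule eq_matI)
    fix i j assume "i < dim_row (P * D * transpose_mat P)" "j < dim_col (P * D * transpose_mat P)"
    then have ij: "i < 4" "j < 4" using carr by simp_all
    then show "target a b $$ (i, j) = (P * D * transpose_mat P) $$ (i, j)"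
      using s unfolding mult_mat_4[OF PD carr(3) ij] less_4_cases
      by (elim disjE; simp add: PD_entry PT P target_def outer_sum_def del: index_mult_mat)
  qed (use carr in auto)
  ultimately have "similar_mat_wit (target a b) D P (transpose_mat P)"
    using carr by (auto simp: similar_mat_wit_def Let_def)
  then have "char_poly (target a b) = char_poly D"
    by (intro char_poly_similar) (auto simp: similar_mat_def)
  also have "\<dots> = (\<Prod>e\<leftarrow>diag_mat D. [:- e, 1:])"
    by (rule char_poly_upper_triangular[OF carr(2)]) (auto simp: D_def)
  also have "diag_mat D = [1 / 2, 1 / 2, 0, 0]"
    by (simp add: diag_mat_def D_def eval_nat_numeral upt_rec)
  finally show ?thesis .
qed

lemma proots_prod_linear: "proots (\<Prod>e\<leftarrow>es. [:- e, 1:]) = mset es" for es :: "complex list"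
proof (induction es)
  case (Cons e es)
  have "(\<Prod>e\<leftarrow>es. [:- e, 1:]) \<noteq> 0" by (auto simp: prod_list_zero_iff)
  then have "proots ([:- e, 1:] * (\<Prod>e\<leftarrow>es. [:- e, 1:])) = {#e#} + mset es"
    using Cons by (subst proots_mult) auto
  then show ?case by simp
qed simp

lemma target_in_states:
  assumes "a\<^sup>2 + b\<^sup>2 = 1"
  shows "target a b \<in> states_with_spectrum [1 / 2, 1 / 2, 0, 0]"
proof -
  have s: "complex_of_real (sqrt 2) * complex_of_real (sqrt 2) = 2"
    by (simp flip: of_real_mult)
  have "psd (2 * 2) (target a b)"
    unfolding target_def outer_sum_def by (rule psd_rank_one_sum)
  moreover have "mat_trace (target a b) = 1"
  proof -
    have "mat_trace (target a b) = of_real (1 / 2 + a\<^sup>2 / 2 + b\<^sup>2 / 2)"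
      using s by (simp add: mat_trace_def target_def outer_sum_def sum_lessThan_4 power2_eq_square)
    also have "1 / 2 + a\<^sup>2 / 2 + b\<^sup>2 / 2 = 1" using assms by simp
    finally show ?thesis by simp
  qed
  moreover have "has_spectrum (target a b) [1 / 2, 1 / 2, 0, 0]"
    unfolding has_spectrum_def target_char_poly[OF assms] proots_prod_linear by simp
  ultimately show ?thesis by (simp add: states_with_spectrum_def two_qubit_state_def)
qed

section \<open>States with a doubly degenerate eigenvalue\<close>

text \<open>Triangularise \<open>A\<close> with the double eigenvalue in the first two diagonal
  places. The first two columns \<open>p\<close>, \<open>q\<close> of the basis change satisfy A p =
  l p and A q = t p + l q, and Hermiticity forces t = 0.\<close>

lemma psd_double_eigenspace:
  assumes psd: "psd n A" and n: "2 \<le> n"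
    and cp: "char_poly A = (\<Prod>e\<leftarrow>l # l # es. [:- e, 1:])" and l: "l \<in> \<real>"
  shows "\<exists>p q. (\<forall>i<n. (\<Sum>j<n. A $$ (i, j) * p j) = l * p i) \<and>
    (\<forall>i<n. (\<Sum>j<n. A $$ (i, j) * q j) = l * q i) \<and>
    (\<forall>x y. (\<forall>i<n. x * p i + y * q i = 0) \<longrightarrow> x = 0 \<and> y = 0)"
proof -
  have A: "A \<in> carrier_mat n n" using psd by (simp add: psd_def)
  have herm: "A $$ (j, i) = cnj (A $$ (i, j))" if "i < n" "j < n" for i j
    using psd that unfolding psd_iff by blast
  obtain B P Q where schur: "schur_decomposition A (l # l # es) = (B, P, Q)"
    by (cases "schur_decomposition A (l # l # es)")
  from schur_decomposition[OF A cp schur] have sim: "similar_mat_wit A B P Q"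
    and ut: "upper_triangular B" and diag: "diag_mat B = l # l # es" by auto
  note w = similar_mat_witD2[OF A sim]
  have B: "B $$ (0, 0) = l" "B $$ (1, 1) = l" "B $$ (1, 0) = 0" "\<And>k. 1 < k \<Longrightarrow> k < n \<Longrightarrow> B $$ (k, 0) = 0 \<and> B $$ (k, 1) = 0"
  proof -
    have diag_B: "map (\<lambda>i. B $$ (i, i)) [0..<n] = l # l # es"
      using diag w(5) by (simp add: diag_mat_def)
    have "B $$ (i, i) = (l # l # es) ! i" if "i < n" for i
      unfolding diag_B[symmetric] using that by simp
    from this[of 0] this[of 1] n show "B $$ (0, 0) = l" "B $$ (1, 1) = l" by simp_all
    show "B $$ (1, 0) = 0" "\<And>k. 1 < k \<Longrightarrow> k < n \<Longrightarrow> B $$ (k, 0) = 0 \<and> B $$ (k, 1) = 0"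
      using ut w(5) n by (auto simp: upper_triangular_def)
  qed
  have "P * B * Q * P = P * B * (Q * P)"
    by (rule assoc_mult_mat[OF mult_carrier_mat[OF w(6) w(5)] w(7) w(6)])
  then have AP: "A * P = P * B"
    unfolding w(3)[symmetric] w(2) right_mult_one_mat[OF mult_carrier_mat[OF w(6) w(5)]] .
  define p q where "p i = P $$ (i, 0)" and "q i = P $$ (i, 1)" for i
  define t where "t = B $$ (0, 1)"
  have entry: "(X * Y) $$ (i, j) = (\<Sum>k<n. X $$ (i, k) * Y $$ (k, j))"
    if "X \<in> carrier_mat n n" "Y \<in> carrier_mat n n" "i < n" "j < n" for X Y :: "complex mat" and i j
    using that by (simp add: scalar_prod_def atLeast0LessThan)
  have two_terms: "(\<Sum>k<n. F k) = F 0 + F 1" if "\<And>k. 1 < k \<Longrightarrow> k < n \<Longrightarrow> F k = 0" for F :: "nat \<Rightarrow> complex"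
  proof -
    have "(\<Sum>k<n. F k) = (\<Sum>k\<in>{0, 1}. F k)"
      using n that by (intro sum.mono_neutral_right) auto
    then show ?thesis by simp
  qed
  have Ap: "(\<Sum>j<n. A $$ (i, j) * p j) = l * p i" if "i < n" for i
  proof -
    have "(\<Sum>j<n. A $$ (i, j) * p j) = (\<Sum>k<n. P $$ (i, k) * B $$ (k, 0))"
      using entry[OF A w(6) that, of 0] entry[OF w(6) w(5) that, of 0] n AP by (simp add: p_def)
    also have "\<dots> = P $$ (i, 0) * B $$ (0, 0) + P $$ (i, 1) * B $$ (1, 0)"
      by (rule two_terms) (simp add: B)
    finally show ?thesis using B by (simp add: p_def mult.commute)
  qed
  have Aq': "(\<Sum>j<n. A $$ (i, j) * q j) = t * p i + l * q i" if "i < n" for i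
  proof -
    have "(\<Sum>j<n. A $$ (i, j) * q j) = (\<Sum>k<n. P $$ (i, k) * B $$ (k, 1))"
      using entry[OF A w(6) that, of 1] entry[OF w(6) w(5) that, of 1] n AP by (simp add: q_def)
    also have "\<dots> = P $$ (i, 0) * B $$ (0, 1) + P $$ (i, 1) * B $$ (1, 1)"
      by (rule two_terms) (use B in auto)
    finally show ?thesis using B(2) by (simp add: p_def q_def t_def mult.commute)
  qed
  have Qp: "(\<Sum>k<n. Q $$ (i, k) * P $$ (k, j)) = (if i = j then 1 else 0)" if "i < n" "j < n" for i j
    using entry[OF w(7) w(6) that] w(2) that by simp
  \<comment> \<open>The columns of an invertible matrix are independent: applying rows 0 and 1 of
    the inverse \<open>Q\<close> to the combination returns \<open>x\<close> and
    \<open>y\<close>.\<close>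
  have indep: "x = 0 \<and> y = 0" if z: "\<And>i. i < n \<Longrightarrow> x * p i + y * q i = 0" for x y
  proof -
    have comb: "x * (\<Sum>k<n. Q $$ (i, k) * P $$ (k, 0)) + y * (\<Sum>k<n. Q $$ (i, k) * P $$ (k, 1)) = 0" for i
    proof -
      have "x * (\<Sum>k<n. Q $$ (i, k) * P $$ (k, 0)) + y * (\<Sum>k<n. Q $$ (i, k) * P $$ (k, 1))
          = (\<Sum>k<n. Q $$ (i, k) * (x * p k + y * q k))"
        by (simp add: sum_distrib_left sum.distrib p_def q_def algebra_simps)
      also have "\<dots> = 0" using z by simp
      finally show ?thesis .
    qed
    from comb[of 0] comb[of 1] show ?thesis using n Qp[of 0 0] Qp[of 0 1] Qp[of 1 0] Qp[of 1 1] by simp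
  qed
  \<comment> \<open>Computing the inner product of \<open>p\<close> with A q directly and by moving
    \<open>A\<close> onto \<open>p\<close> leaves t times the squared norm of
    \<open>p\<close>.\<close>
  have "t * (\<Sum>i<n. cnj (p i) * p i) = 0"
  proof -
    have "(\<Sum>i<n. cnj (p i) * (\<Sum>j<n. A $$ (i, j) * q j)) = (\<Sum>j<n. \<Sum>i<n. cnj (p i) * A $$ (i, j) * q j)"
      by (simp add: sum_distrib_left mult.assoc) (rule sum.swap)
    also have "\<dots> = (\<Sum>j<n. cnj (\<Sum>i<n. A $$ (j, i) * p i) * q j)"
    proof -
      have "(\<Sum>i<n. cnj (p i) * A $$ (i, j) * q j) = cnj (\<Sum>i<n. A $$ (j, i) * p i) * q j" if j: "j < n" for j
        unfolding cnj_sum sum_distrib_right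
      proof (rule sum.cong[OF refl])
        fix i assume "i \<in> {..<n}"
        then have "A $$ (i, j) = cnj (A $$ (j, i))" using herm[OF j] by simp
        then show "cnj (p i) * A $$ (i, j) * q j = cnj (A $$ (j, i) * p i) * q j" by simp
      qed
      then show ?thesis by simp
    qed
    also have "\<dots> = (\<Sum>j<n. l * (cnj (p j) * q j))"
      using l by (intro sum.cong) (auto simp: Ap Reals_cnj_iff mult.assoc)
    finally have "(\<Sum>i<n. cnj (p i) * (t * p i + l * q i)) = (\<Sum>j<n. l * (cnj (p j) * q j))"
      by (simp add: Aq')
    then show ?thesis by (simp add: algebra_simps sum.distrib sum_distrib_left)
  qed
  moreover have "(\<Sum>i<n. cnj (p i) * p i) \<noteq> 0"
  proof
    assume "(\<Sum>i<n. cnj (p i) * p i) = 0"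
    then have "complex_of_real (\<Sum>i<n. (cmod (p i))\<^sup>2) = 0"
      by (simp only: of_real_sum complex_norm_square mult.commute)
    then have "(\<Sum>i<n. (cmod (p i))\<^sup>2) = 0" by (simp only: of_real_eq_0_iff)
    then have "\<forall>i<n. p i = 0" by (subst (asm) sum_nonneg_eq_0_iff) auto
    then show False using indep[of 1 0] by simp
  qed
  ultimately have "t = 0" by simp
  then have Aq: "(\<Sum>j<n. A $$ (i, j) * q j) = l * q i" if "i < n" for i
    using Aq'[OF that] by simp
  show ?thesis using Ap Aq indep by blast
qed

section \<open>Product vectors in two-dimensional subspaces\<close>

lemma product_vector_in_plane:
  fixes p q :: "nat \<Rightarrow> complex"
  assumes indep: "\<forall>x y. (\<forall>i<4. x * p i + y * q i = 0) \<longrightarrow> x = 0 \<and> y = 0"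
  obtains x y f g where "(cmod (f 0))\<^sup>2 + (cmod (f 1))\<^sup>2 = 1" "(cmod (g 0))\<^sup>2 + (cmod (g 1))\<^sup>2 = 1"
    "\<And>i. i < 4 \<Longrightarrow> prod_vec f g i = x * p i + y * q i"
proof -
  \<comment> \<open>The determinant of the vector read as a 2 by 2 matrix; it vanishes exactly on
    product vectors.\<close>
  define dt where "dt v = v 0 * v 3 - v 1 * v (2::nat)" for v :: "nat \<Rightarrow> complex"
  obtain x y v where v: "\<And>i. v i = x * p i + y * q i" and xy: "x \<noteq> 0 \<or> y \<noteq> 0" and dv: "dt v = 0"
  proof (cases "dt q = 0")
    case True
    then show ?thesis by (intro that[of q 0 1]) auto
  next
    case False
    \<comment> \<open>The determinant of p + y q as a polynomial in \<open>y\<close>; its leading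
      coefficient \<open>dt q\<close> is nonzero, so it has a root.\<close>
    define F where "F = [:dt p, p 0 * q 3 + q 0 * p 3 - p 1 * q 2 - q 1 * p 2, dt q:]"
    have "degree F \<noteq> 0" using False by (simp add: F_def)
    then obtain y where "poly F y = 0"
      using alg_closed_imp_poly_has_root[of F] by auto
    then have "dt (\<lambda>i. p i + y * q i) = 0"
      by (simp add: F_def dt_def algebra_simps)
    then show ?thesis by (intro that[of "\<lambda>i. p i + y * q i" 1 y]) auto
  qed
  have "\<exists>i<4. v i \<noteq> 0" using indep xy unfolding v by blast
  then have "v 0 \<noteq> 0 \<or> v 1 \<noteq> 0 \<or> v 2 \<noteq> 0 \<or> v 3 \<noteq> 0" by (auto simp: less_4_cases)
  then obtain f g :: "nat \<Rightarrow> complex" where fg: "\<And>i. i < 4 \<Longrightarrow> v i = prod_vec f g i"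
    and f: "f 0 \<noteq> 0 \<or> f 1 \<noteq> 0" and g: "g 0 \<noteq> 0 \<or> g 1 \<noteq> 0"
  proof -
    have dv': "v 0 * v 3 = v 1 * v 2" using dv by (simp add: dt_def)
    consider "v 0 \<noteq> 0 \<or> v 2 \<noteq> 0" | "v 0 = 0" "v 2 = 0" by blast
    then show thesis
    proof cases
      case 1
      \<comment> \<open>Rank-one factorisation: \<open>f\<close> is the first column, and
        \<open>g\<close> is a row \<open>r\<close> whose first entry is nonzero, divided by that
        entry.\<close>
      define r :: nat where "r = (if v 0 \<noteq> 0 then 0 else 1)"
      have r: "v (r * 2) \<noteq> 0" using 1 by (simp add: r_def)
      show thesis
      proof (rule that[of "\<lambda>p. v (p * 2)" "\<lambda>q. v (r * 2 + q) / v (r * 2)"])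
        show "v i = prod_vec (\<lambda>p. v (p * 2)) (\<lambda>q. v (r * 2 + q) / v (r * 2)) i" if "i < 4" for i
          using that[unfolded less_4_cases] r dv'
          by (elim disjE; cases "v 0 = 0"; simp add: prod_vec_def r_def field_simps numeral_2_eq_2[symmetric])
      qed (use 1 r in \<open>auto simp: r_def\<close>)
    next
      case 2
      show thesis
      \<comment> \<open>The first column vanishes, so \<open>v\<close> is its second column tensor
        the second basis vector, which is \<open>of_nat\<close> on the indices 0 and 1.\<close>
      proof (rule that[of "\<lambda>p. v (p * 2 + 1)" "\<lambda>q. of_nat q"])
        show "v i = prod_vec (\<lambda>p. v (p * 2 + 1)) (\<lambda>q. of_nat q) i" if "i < 4" for i
          using that[unfolded less_4_cases] 2
          by (elim disjE; simp add: prod_vec_def)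
        show "v (0 * 2 + 1) \<noteq> 0 \<or> v (1 * 2 + 1) \<noteq> 0"
          using \<open>v 0 \<noteq> 0 \<or> v 1 \<noteq> 0 \<or> v 2 \<noteq> 0 \<or> v 3 \<noteq> 0\<close> 2 by (simp add: eval_nat_numeral)
      qed simp
    qed
  qed
  define nm where "nm h = sqrt ((cmod (h 0))\<^sup>2 + (cmod (h 1))\<^sup>2)" for h :: "nat \<Rightarrow> complex"
  have nm: "nm h > 0" if "h 0 \<noteq> 0 \<or> h 1 \<noteq> 0" for h
    using that by (auto simp: nm_def add_pos_nonneg add_nonneg_pos)
  have unit: "(cmod (h 0 / nm h))\<^sup>2 + (cmod (h 1 / nm h))\<^sup>2 = 1" if "h 0 \<noteq> 0 \<or> h 1 \<noteq> 0" for h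
  proof -
    have "(nm h)\<^sup>2 = (cmod (h 0))\<^sup>2 + (cmod (h 1))\<^sup>2" by (simp add: nm_def)
    moreover have "(nm h)\<^sup>2 > 0" using nm[OF that] by simp
    ultimately show ?thesis
      using that by (simp add: norm_divide power_divide flip: add_divide_distrib)
  qed
  show ?thesis
  proof (rule that[of "\<lambda>i. f i / nm f" "\<lambda>i. g i / nm g" "x / (nm f * nm g)" "y / (nm f * nm g)"])
    show "prod_vec (\<lambda>i. f i / nm f) (\<lambda>i. g i / nm g) i
        = x / (nm f * nm g) * p i + y / (nm f * nm g) * q i" if "i < 4" for i
      using fg[OF that] v[of i] by (simp add: prod_vec_def flip: add_divide_distrib)
  qed (use unit[OF f] unit[OF g] in auto)
qed


section \<open>Splitting a product eigenvector off the state\<close>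

lemma char_poly_of_spectrum:
  assumes "A \<in> carrier_mat n n" "has_spectrum A ls"
  shows "char_poly A = (\<Prod>e\<leftarrow>map complex_of_real ls. [:- e, 1:])"
proof -
  have "lead_coeff (char_poly A) = 1" using degree_monic_char_poly[OF assms(1)] by simp
  then have "char_poly A = (\<Prod>e\<in>#proots (char_poly A). [:- e, 1:])"
    using complex_poly_decompose_multiset[of "char_poly A"] by simp
  also have "proots (char_poly A) = mset (map complex_of_real ls)"
    using assms(2) unfolding has_spectrum_def by (elim conjE) (rule sym)
  also have "(\<Prod>e\<in>#mset (map complex_of_real ls). [:- e, 1:])
      = (\<Prod>e\<leftarrow>map complex_of_real ls. [:- e, 1:])"
    by (simp flip: mset_map add: prod_mset_prod_list)
  finally show ?thesis .
qed

text \<open>Removing l times the projection onto a unit eigenvector \<open>v\<close> keeps the form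
  positive: its value at \<open>c\<close> is the value of the form of \<open>A\<close> at the
  component of \<open>c\<close> orthogonal to \<open>v\<close>.\<close>

lemma eigenvector_complement_decomposition:
  assumes "psd n A"
    and ev: "\<And>i. i < n \<Longrightarrow> (\<Sum>j<n. A $$ (i, j) * v j) = l * v i" and l: "l \<in> \<real>"
    and v: "(\<Sum>i<n. v i * cnj (v i)) = 1"
  obtains us where "\<And>i j. i < n \<Longrightarrow> j < n \<Longrightarrow> A $$ (i, j) = l * v i * cnj (v j) + (\<Sum>u\<leftarrow>us. u i * cnj (u j))"
proof -
  have herm: "A $$ (j, i) = cnj (A $$ (i, j))" if "i < n" "j < n" for i j
    using assms(1) that unfolding psd_iff by blast
  define Q where "Q c = (\<Sum>i<n. \<Sum>j<n. cnj (c i) * A $$ (i, j) * c j)" for c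
  have Q: "0 \<le> Q c" for c using assms(1) unfolding psd_iff Q_def by blast
  define M where "M i j = A $$ (i, j) - l * v i * cnj (v j)" for i j
  have "\<exists>us. \<forall>i\<in>{..<n}. \<forall>j\<in>{..<n}. M i j = (\<Sum>u\<leftarrow>us. u i * cnj (u j))"
  proof (rule psd_kernel_decomposition)
    show "M j i = cnj (M i j)" if "i \<in> {..<n}" "j \<in> {..<n}" for i j
    proof -
      have "A $$ (j, i) = cnj (A $$ (i, j))" by (rule herm) (use that in auto)
      then show ?thesis using l by (simp add: M_def Reals_cnj_iff)
    qed
    show "0 \<le> (\<Sum>i<n. \<Sum>j<n. cnj (c i) * M i j * c j)" for c
    proof -
      define \<alpha> where "\<alpha> = (\<Sum>j<n. cnj (v j) * c j)"
      have ca: "(\<Sum>i<n. cnj (c i) * v i) = cnj \<alpha>"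
        by (simp add: \<alpha>_def mult.commute)
      have L: "(\<Sum>i<n. \<Sum>j<n. cnj (x i) * A $$ (i, j) * v j) = l * (\<Sum>i<n. cnj (x i) * v i)" for x
      proof -
        have "(\<Sum>i<n. \<Sum>j<n. cnj (x i) * A $$ (i, j) * v j) = (\<Sum>i<n. cnj (x i) * (l * v i))"
          by (simp add: ev[symmetric] sum_distrib_left mult.assoc)
        then show ?thesis by (simp add: sum_distrib_left mult_ac)
      qed
      have R: "(\<Sum>i<n. \<Sum>j<n. cnj (v i) * A $$ (i, j) * x j) = l * (\<Sum>j<n. cnj (v j) * x j)" for x
      proof -
        have "(\<Sum>i<n. \<Sum>j<n. cnj (v i) * A $$ (i, j) * x j)
            = (\<Sum>i<n. \<Sum>j<n. cnj (cnj (x j) * A $$ (j, i) * v i))"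
        proof (intro sum.cong refl)
          fix i j assume "i \<in> {..<n}" "j \<in> {..<n}"
          then have "A $$ (i, j) = cnj (A $$ (j, i))" using herm[of j i] by simp
          then show "cnj (v i) * A $$ (i, j) * x j = cnj (cnj (x j) * A $$ (j, i) * v i)" by simp
        qed
        also have "\<dots> = cnj (\<Sum>j<n. \<Sum>i<n. cnj (x j) * A $$ (j, i) * v i)"
          unfolding cnj_sum by (rule sum.swap)
        also have "\<dots> = l * (\<Sum>j<n. cnj (v j) * x j)"
          unfolding L using l by (simp add: Reals_cnj_iff mult.commute)
        finally show ?thesis .
      qed
      have vv: "(\<Sum>i<n. cnj (v i) * v i) = 1" using v by (simp add: mult.commute)
      \<comment> \<open>With \<open>\<alpha>\<close> the inner product of \<open>v\<close> and
        \<open>c\<close>, the three mixed terms are each l times the squared modulus of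
        \<open>\<alpha>\<close> up to sign, and together they subtract it once.\<close>
      have "Q (\<lambda>i. c i - \<alpha> * v i) = Q c - \<alpha> * (\<Sum>i<n. \<Sum>j<n. cnj (c i) * A $$ (i, j) * v j)
          - cnj \<alpha> * (\<Sum>i<n. \<Sum>j<n. cnj (v i) * A $$ (i, j) * c j)
          + \<alpha> * cnj \<alpha> * (\<Sum>i<n. \<Sum>j<n. cnj (v i) * A $$ (i, j) * v j)"
        by (simp add: Q_def sum_distrib_left sum.distrib sum_subtractf algebra_simps)
      also have "\<dots> = Q c - l * \<alpha> * cnj \<alpha>"
        unfolding L R ca vv \<alpha>_def[symmetric] by (simp add: algebra_simps)
      also have "\<dots> = (\<Sum>i<n. \<Sum>j<n. cnj (c i) * M i j * c j)"
      proof -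
        have "(\<Sum>i<n. \<Sum>j<n. cnj (c i) * M i j * c j)
            = Q c - l * ((\<Sum>i<n. cnj (c i) * v i) * (\<Sum>j<n. cnj (v j) * c j))"
          unfolding sum_product
          by (simp add: Q_def M_def sum_distrib_left sum_subtractf algebra_simps)
        then show ?thesis unfolding ca \<alpha>_def[symmetric] by (simp add: mult_ac)
      qed
      finally show ?thesis using Q by metis
    qed
  qed simp
  then obtain us where "\<And>i j. i < n \<Longrightarrow> j < n \<Longrightarrow> M i j = (\<Sum>u\<leftarrow>us. u i * cnj (u j))" by blast
  then show ?thesis by (intro that[of us]) (simp add: M_def algebra_simps)
qed

text \<open>The eigenspace of 1/2 is at least two-dimensional and so contains a unit product vector.
  Splitting off half its projection leaves a positive remainder of trace 1/2.\<close>

lemma state_decomposition: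
  assumes "\<tau> \<in> states_with_spectrum [1 / 2, 1 / 2, 0, 0]"
  obtains f g us where "(cmod (f 0))\<^sup>2 + (cmod (f 1))\<^sup>2 = 1" "(cmod (g 0))\<^sup>2 + (cmod (g 1))\<^sup>2 = 1"
    "\<tau> = outer_sum ((\<lambda>p. 1 / sqrt 2 * prod_vec f g p) # us)"
    "(\<Sum>u\<leftarrow>us. \<Sum>p<4. (cmod (u p))\<^sup>2) = 1 / 2"
proof -
  have psd: "psd 4 \<tau>" and tr: "mat_trace \<tau> = 1" and sp: "has_spectrum \<tau> [1 / 2, 1 / 2, 0, 0]"
    using assms by (auto simp: states_with_spectrum_def two_qubit_state_def)
  have carr: "\<tau> \<in> carrier_mat 4 4" using psd by (simp add: psd_def)
  have cp: "char_poly \<tau> = (\<Prod>e\<leftarrow>1 / 2 # 1 / 2 # [0, 0]. [:- e, 1:])"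
    using char_poly_of_spectrum[OF carr sp] by simp
  have two: "(2::nat) \<le> 4" and half_real: "1 / 2 \<in> (\<real> :: complex set)" by simp_all
  obtain p q where
    pq: "\<And>i. i < 4 \<Longrightarrow> (\<Sum>j<4. \<tau> $$ (i, j) * p j) = 1 / 2 * p i"
        "\<And>i. i < 4 \<Longrightarrow> (\<Sum>j<4. \<tau> $$ (i, j) * q j) = 1 / 2 * q i"
    and indep: "\<forall>x y. (\<forall>i<4. x * p i + y * q i = 0) \<longrightarrow> x = 0 \<and> y = 0"
    using psd_double_eigenspace[OF psd two cp half_real] by blast
  obtain x y f g where f: "(cmod (f 0))\<^sup>2 + (cmod (f 1))\<^sup>2 = 1" and g: "(cmod (g 0))\<^sup>2 + (cmod (g 1))\<^sup>2 = 1"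
    and fg: "\<And>i. i < 4 \<Longrightarrow> prod_vec f g i = x * p i + y * q i"
    using product_vector_in_plane[OF indep] by metis
  have ev: "(\<Sum>j<4. \<tau> $$ (i, j) * prod_vec f g j) = 1 / 2 * prod_vec f g i" if "i < 4" for i
  proof -
    have "(\<Sum>j<4. \<tau> $$ (i, j) * prod_vec f g j) = (\<Sum>j<4. \<tau> $$ (i, j) * (x * p j + y * q j))"
      by (simp add: fg)
    also have "\<dots> = x * (\<Sum>j<4. \<tau> $$ (i, j) * p j) + y * (\<Sum>j<4. \<tau> $$ (i, j) * q j)"
      by (simp add: sum_distrib_left sum.distrib algebra_simps)
    also have "\<dots> = 1 / 2 * (x * p i + y * q i)"
      unfolding pq[OF that] by (simp add: algebra_simps)
    finally show ?thesis unfolding fg[OF that] .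
  qed
  have nv: "(\<Sum>i<4. (cmod (prod_vec f g i))\<^sup>2) = 1"
    using f g by (simp add: norm_prod_vec)
  then have v: "(\<Sum>i<4. prod_vec f g i * cnj (prod_vec f g i)) = 1"
    unfolding complex_norm_square[symmetric] of_real_sum[symmetric] by simp
  obtain us where us: "\<And>i j. i < 4 \<Longrightarrow> j < 4 \<Longrightarrow> \<tau> $$ (i, j)
      = 1 / 2 * prod_vec f g i * cnj (prod_vec f g j) + (\<Sum>u\<leftarrow>us. u i * cnj (u j))"
    by (rule eigenvector_complement_decomposition[OF psd ev half_real v], assumption+) (rule that)
  have s: "complex_of_real (sqrt 2) * complex_of_real (sqrt 2) = 2"
    by (simp flip: of_real_mult)
  have "\<tau> = outer_sum ((\<lambda>p. 1 / sqrt 2 * prod_vec f g p) # us)"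
    using carr s by (intro eq_matI) (auto simp: outer_sum_def us)
  moreover have "(\<Sum>u\<leftarrow>us. \<Sum>p<4. (cmod (u p))\<^sup>2) = 1 / 2"
  proof -
    have "(1::complex) = (\<Sum>i<4. \<tau> $$ (i, i))"
      using tr carr by (simp add: mat_trace_def)
    also have "\<dots> = (\<Sum>i<4. 1 / 2 * (prod_vec f g i * cnj (prod_vec f g i)) + (\<Sum>u\<leftarrow>us. u i * cnj (u i)))"
      by (intro sum.cong refl) (simp add: us)
    also have "\<dots> = 1 / 2 * (\<Sum>i<4. prod_vec f g i * cnj (prod_vec f g i))
        + (\<Sum>u\<leftarrow>us. \<Sum>i<4. u i * cnj (u i))"
      unfolding sum.distrib sum_list_sum_swap sum_distrib_left ..
    also have "(\<Sum>u\<leftarrow>us. \<Sum>i<4. u i * cnj (u i)) = of_real (\<Sum>u\<leftarrow>us. \<Sum>p<4. (cmod (u p))\<^sup>2)"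
      by (simp only: of_real_sum_list of_real_sum complex_norm_square)
    also have "1 / 2 * (\<Sum>i<4. prod_vec f g i * cnj (prod_vec f g i)) = of_real (1 / 2)"
      unfolding v by simp
    finally have "complex_of_real 1 = of_real (1 / 2 + (\<Sum>u\<leftarrow>us. \<Sum>p<4. (cmod (u p))\<^sup>2))"
      by simp
    then have "1 = 1 / 2 + (\<Sum>u\<leftarrow>us. \<Sum>p<4. (cmod (u p))\<^sup>2)" by (simp only: of_real_eq_iff)
    then show ?thesis by simp
  qed
  ultimately show ?thesis using that f g by blast
qed

section \<open>Two targets that exclude each other\<close>

theorem corollary2:
  shows "\<exists>l1 l2 l3 l4 :: real.
    l1 \<ge> l2 \<and> l2 \<ge> l3 \<and> l3 \<ge> l4 \<and> l4 \<ge> 0 \<and> l1 + l2 + l3 + l4 = 1 \<and>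
    \<not> (\<exists>\<rho>. maximally_entangled_in (states_with_spectrum [l1, l2, l3, l4]) \<rho>)"
proof -
  have "False" if "maximally_entangled_in (states_with_spectrum [1 / 2, 1 / 2, 0, 0]) \<tau>" for \<tau>
  proof -
    have \<tau>: "\<tau> \<in> states_with_spectrum [1 / 2, 1 / 2, 0, 0]"
      and reach: "\<And>\<sigma>. \<sigma> \<in> states_with_spectrum [1 / 2, 1 / 2, 0, 0] \<Longrightarrow> \<exists>\<Lambda>. locc_map \<Lambda> \<and> \<Lambda> \<tau> = \<sigma>"
      using that by (auto simp: maximally_entangled_in_def)
    obtain f g us where f: "(cmod (f 0))\<^sup>2 + (cmod (f 1))\<^sup>2 = 1" and g: "(cmod (g 0))\<^sup>2 + (cmod (g 1))\<^sup>2 = 1"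
      and dec: "\<tau> = outer_sum ((\<lambda>p. 1 / sqrt 2 * prod_vec f g p) # us)"
      and half: "(\<Sum>u\<leftarrow>us. \<Sum>p<4. (cmod (u p))\<^sup>2) = 1 / 2"
      using state_decomposition[OF \<tau>] by blast
    \<comment> \<open>A rational point of the unit circle whose larger coordinate has square 16/25,
      above 1/2. Exchanging its coordinates gives the second target, while \<open>f\<close>,
      \<open>g\<close> and \<open>us\<close> depend only on \<open>\<tau>\<close> and stay the
      same.\<close>
    obtain \<Lambda> where "locc_map \<Lambda>" "\<Lambda> \<tau> = target (4 / 5) (3 / 5)"
      using reach[OF target_in_states[of "4 / 5" "3 / 5"]] by (auto simp: power2_eq_square)
    then have 1: "(4 / 5)\<^sup>2 / 2 \<le> (\<Sum>u\<leftarrow>us. (cmod (coord f (perp g) u))\<^sup>2)"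
      unfolding dec by (rule locc_to_target_bounds(1)[OF _ _ f g]) auto
    obtain \<Lambda>' where "locc_map \<Lambda>'" "\<Lambda>' \<tau> = target (3 / 5) (4 / 5)"
      using reach[OF target_in_states[of "3 / 5" "4 / 5"]] by (auto simp: power2_eq_square)
    then have 2: "(4 / 5)\<^sup>2 / 2 \<le> (\<Sum>u\<leftarrow>us. (cmod (coord (perp f) g u))\<^sup>2)"
      unfolding dec by (rule locc_to_target_bounds(2)[OF _ _ f g]) auto
    have "(\<Sum>u\<leftarrow>us. (cmod (coord f (perp g) u))\<^sup>2) + (\<Sum>u\<leftarrow>us. (cmod (coord (perp f) g u))\<^sup>2)
        \<le> (\<Sum>u\<leftarrow>us. \<Sum>p<4. (cmod (u p))\<^sup>2)"
      unfolding sum_list_addf[symmetric] by (intro sum_list_mono bessel_two f g)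
    \<comment> \<open>The two lower bounds add up to 16/25, but the total weight is only
      1/2.\<close>
    then show False using 1 2 half by (simp add: power2_eq_square)
  qed
  then show ?thesis
    by (intro exI[of _ "1 / 2"] exI[of _ "0 :: real"]) auto
qed

end
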